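(* Let $F:\mathbb{S}^{m}_{r_0}\times\mathbb{E}^{n-m}\to\mathbb{E}^{n+1}$, $m\neq 0$, be an isometric immersion of a sphere, when $m=n$, or of a cylinder, when $m\neq n$, in the Euclidean space $\mathbb{E}^{n+1}$, with inward unit normal vector field $N$. Let $m$ principal curvatures be equal to $k=1/r_0$ and, when $m\neq n$, let the other $n-m$ principal curvatures be null. Then the solution to the IMCF by parallel hypersurfaces with initial condition $F$ is eternal and it is given as follows. (i) If $m=n$, $$F^{t}(x)=e^{t/n}F(x),\qquad\forall t\in\mathbb{R},\ x\in\mathbb{S}^{n}_{r_0}.$$ Moreover, $F^{t}(\mathbb{S}^n_{r_0})$ is a sphere centered at the origin with radius $r(t)=r_0e^{t/n}$ that converges to a point when $t\to-\infty$. (ii) If $m\neq n$, $$F^{t}(x,y)=F(x,y)+r_0\,(1-e^{t/m})\,N(x,y),\qquad\forall t\in\mathbb{R},\ (x,y)\in\mathbb{S}^{m}_{r_0}\times\mathbb{E}^{n-m}.$$ Moreover, $F^t(\mathbb{S}^m_{r_0}\times\mathbb{E}^{n-m})$ is a cylinder whose base has radius $r(t)=r_0e^{t/m}$, and it converges to an $(n-m)$-dimensional Euclidean subspace of $\mathbb{E}^{n+1}$ when $t\to-\infty$.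
   Context: $\mathbb{E}^{n+1}$ is the Euclidean space of dimension $n+1$ and $\mathbb{S}^m_{r_0}$ is an $m$-dimensional sphere of radius $r_0$. For an oriented hypersurface $F:M^n\to\mathbb{E}^{n+1}$ with unit normal vector field $N$, the second fundamental form is $II_x(v,w)=-\langle dN_x(v),w\rangle$ (tangent vectors of $M$ being identified with their images under $dF_x$), the principal curvatures $k_1,\dots,k_n$ are its eigenvalues with respect to the induced metric, and the mean curvature is $H=\sum_{i=1}^n k_i$ (not averaged). "Inward" unit normal means the choice of unit normal for which $H>0$. A one-parameter family of hypersurfaces $F^t:M\to\mathbb{E}^{n+1}$, $t\in I$, $0\in I\subset\mathbb{R}$, is a solution to the inverse mean curvature flow (IMCF) with initial condition $F$ if $\frac{\partial F^t}{\partial t}(x)=-\frac{1}{H^t(x)}N^t(x)$ for all $(x,t)\in M\times I$ and $F^0=F$, where $H^t$ is the mean curvature and $N^t$ the inward unit normal vector field of $F^t$, with $H^t(x)>0$ for all $(x,t)\in M\times I$. It is a solution by parallel hypersurfaces if there is a function $\mu:I\to\mathbb{R}$ such that $F^t(x)=F(x)+\mu(t)N(x)$ for all $t\in I$, $x\in M$. The solution is eternal if $I=\mathbb{R}$.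
   Formalization: In (i), the formula e^{t/n}F(x) and "centered at the origin" hold only if F(S^n) is centered at the origin; for general F, the formal version gives F^t = c + e^{t/n}(F − c) with spheres about the centre c of F(S^n), and the stated formula when c = 0. *)

theory Defs
  imports "HOL-Analysis.Analysis"
begin

text \<open>Manifolds are embedded submanifolds \<open>M\<close> of a Euclidean space, given as sets; maps on \<open>M\<close>
  are functions on the ambient space of which only the values on \<open>M\<close> matter.\<close>

subsection \<open>Calculus on a submanifold\<close>

primrec Ck_on :: "nat \<Rightarrow> 'e::euclidean_space set \<Rightarrow> ('e \<Rightarrow> 'a::euclidean_space) \<Rightarrow> bool" where
  "Ck_on 0 U f \<longleftrightarrow> continuous_on U f"
| "Ck_on (Suc k) U f \<longleftrightarrow>
     f differentiable_on U \<and> (\<forall>v. Ck_on k U (\<lambda>x. frechet_derivative f (at x) v))"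

definition smooth_map :: "'e::euclidean_space set \<Rightarrow> ('e \<Rightarrow> 'a::euclidean_space) \<Rightarrow> bool" where
  "smooth_map M f \<longleftrightarrow>
     (\<forall>x\<in>M. \<exists>U g. open U \<and> x \<in> U \<and> (\<forall>k. Ck_on k U g) \<and> (\<forall>y\<in>M \<inter> U. g y = f y))"

definition tangent_space :: "'e::euclidean_space set \<Rightarrow> 'e \<Rightarrow> 'e set" where
  "tangent_space M x =
     {v. \<exists>\<gamma>::real \<Rightarrow> 'e. \<gamma> 0 = x \<and> (\<forall>\<^sub>F s in nhds 0. \<gamma> s \<in> M) \<and> (\<gamma> has_vector_derivative v) (at 0)}"

text \<open>A derivative within \<open>M\<close> is in general not unique as a linear map on the ambient space, but
  any two of them agree on the tangent space. The following is only ever applied to tangent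
  vectors.\<close>

abbreviation differential ::
    "'e::euclidean_space set \<Rightarrow> ('e \<Rightarrow> 'a::euclidean_space) \<Rightarrow> 'e \<Rightarrow> 'e \<Rightarrow> 'a" where
  "differential M f x \<equiv> frechet_derivative f (at x within M)"

definition immersion :: "'e::euclidean_space set \<Rightarrow> ('e \<Rightarrow> 'a::euclidean_space) \<Rightarrow> bool" where
  "immersion M F \<longleftrightarrow> smooth_map M F \<and> (\<forall>x\<in>M. inj_on (differential M F x) (tangent_space M x))"

definition induced_metric ::
    "'e::euclidean_space set \<Rightarrow> ('e \<Rightarrow> 'a::euclidean_space) \<Rightarrow> 'e \<Rightarrow> 'e \<Rightarrow> 'e \<Rightarrow> real" where
  "induced_metric M F x v w = differential M F x v \<bullet> differential M F x w"

definition isometric_immersion ::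
    "'e::euclidean_space set \<Rightarrow> ('e \<Rightarrow> 'a::euclidean_space) \<Rightarrow> bool" where
  "isometric_immersion M F \<longleftrightarrow> immersion M F \<and>
     (\<forall>x\<in>M. \<forall>v\<in>tangent_space M x. \<forall>w\<in>tangent_space M x. induced_metric M F x v w = v \<bullet> w)"

subsection \<open>Extrinsic geometry of an oriented hypersurface\<close>

definition unit_normal_field ::
    "'e::euclidean_space set \<Rightarrow> ('e \<Rightarrow> 'a::euclidean_space) \<Rightarrow> ('e \<Rightarrow> 'a) \<Rightarrow> bool" where
  "unit_normal_field M F N \<longleftrightarrow> smooth_map M N \<and>
     (\<forall>x\<in>M. norm (N x) = 1 \<and> (\<forall>v\<in>tangent_space M x. N x \<bullet> differential M F x v = 0))"

definition second_fundamental_form ::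
    "'e::euclidean_space set \<Rightarrow> ('e \<Rightarrow> 'a::euclidean_space) \<Rightarrow> ('e \<Rightarrow> 'a) \<Rightarrow> 'e \<Rightarrow> 'e \<Rightarrow> 'e \<Rightarrow> real" where
  "second_fundamental_form M F N x v w = - (differential M N x v \<bullet> differential M F x w)"

text \<open>Eigenspaces of the second fundamental form with respect to the induced metric.\<close>

definition principal_space ::
    "'e::euclidean_space set \<Rightarrow> ('e \<Rightarrow> 'a::euclidean_space) \<Rightarrow> ('e \<Rightarrow> 'a) \<Rightarrow> 'e \<Rightarrow> real \<Rightarrow> 'e set" where
  "principal_space M F N x \<kappa> =
     {v \<in> tangent_space M x. \<forall>w\<in>tangent_space M x.
        second_fundamental_form M F N x v w = \<kappa> * induced_metric M F x v w}"

definition principal_curvatures ::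
    "'e::euclidean_space set \<Rightarrow> ('e \<Rightarrow> 'a::euclidean_space) \<Rightarrow> ('e \<Rightarrow> 'a) \<Rightarrow> 'e \<Rightarrow> real set" where
  "principal_curvatures M F N x = {\<kappa>. \<exists>v\<in>principal_space M F N x \<kappa>. v \<noteq> 0}"

text \<open>The second fundamental form is symmetric, so the geometric multiplicities used here are the
  multiplicities of \<open>\<kappa>\<close> in the list \<open>k\<^sub>1, \<dots>, k\<^sub>n\<close>.\<close>

definition mean_curvature ::
    "'e::euclidean_space set \<Rightarrow> ('e \<Rightarrow> 'a::euclidean_space) \<Rightarrow> ('e \<Rightarrow> 'a) \<Rightarrow> 'e \<Rightarrow> real" where
  "mean_curvature M F N x =
     (\<Sum>\<kappa>\<in>principal_curvatures M F N x. real (dim (principal_space M F N x \<kappa>)) * \<kappa>)"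

definition inward_unit_normal ::
    "'e::euclidean_space set \<Rightarrow> ('e \<Rightarrow> 'a::euclidean_space) \<Rightarrow> ('e \<Rightarrow> 'a) \<Rightarrow> bool" where
  "inward_unit_normal M F N \<longleftrightarrow> unit_normal_field M F N \<and> (\<forall>x\<in>M. mean_curvature M F N x > 0)"

subsection \<open>Inverse mean curvature flow\<close>

text \<open>\<open>I\<close> is a nondegenerate interval containing 0; at an endpoint belonging to \<open>I\<close> the time
  derivative is one-sided.\<close>

definition imcf_solution ::
    "'e::euclidean_space set \<Rightarrow> real set \<Rightarrow> ('e \<Rightarrow> 'a::euclidean_space) \<Rightarrow> (real \<Rightarrow> 'e \<Rightarrow> 'a) \<Rightarrow> bool" where
  "imcf_solution M I F Ft \<longleftrightarrow>
     is_interval I \<and> 0 \<in> I \<and> I \<noteq> {0} \<and> (\<forall>x\<in>M. Ft 0 x = F x) \<and>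
     (\<exists>N. \<forall>t\<in>I. immersion M (Ft t) \<and> inward_unit_normal M (Ft t) (N t) \<and>
        (\<forall>x\<in>M. ((\<lambda>s. Ft s x) has_vector_derivative
           (- (1 / mean_curvature M (Ft t) (N t) x)) *\<^sub>R N t x) (at t within I)))"

definition imcf_parallel_solution ::
    "'e::euclidean_space set \<Rightarrow> real set \<Rightarrow> ('e \<Rightarrow> 'a::euclidean_space) \<Rightarrow> ('e \<Rightarrow> 'a) \<Rightarrow>
     (real \<Rightarrow> 'e \<Rightarrow> 'a) \<Rightarrow> bool" where
  "imcf_parallel_solution M I F N Ft \<longleftrightarrow> imcf_solution M I F Ft \<and>
     (\<exists>\<mu>::real \<Rightarrow> real. \<forall>t\<in>I. \<forall>x\<in>M. Ft t x = F x + \<mu> t *\<^sub>R N x)"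

subsection \<open>Cylinders and convergence of sets\<close>

text \<open>The cylinder with axis \<open>c + V\<close> over the sphere of radius \<open>r\<close> in the orthogonal complement
  of \<open>V\<close>.\<close>

definition cylinder :: "'a::euclidean_space \<Rightarrow> 'a set \<Rightarrow> real \<Rightarrow> 'a set" where
  "cylinder c V r = {c + u + v | u v. u \<in> V\<^sup>\<bottom> \<and> norm u = r \<and> v \<in> V}"

text \<open>Convergence in the Hausdorff distance, which is allowed to take the value \<open>\<infinity>\<close>, so that
  the sets need not be bounded.\<close>

definition hausdorff_tendsto ::
    "('i \<Rightarrow> 'a::metric_space set) \<Rightarrow> 'a set \<Rightarrow> 'i filter \<Rightarrow> bool" where
  "hausdorff_tendsto A L \<F> \<longleftrightarrow>
     (\<forall>\<epsilon>>0. \<forall>\<^sub>F t in \<F>. (\<forall>a\<in>A t. \<exists>l\<in>L. dist a l < \<epsilon>) \<and> (\<forall>l\<in>L. \<exists>a\<in>A t. dist a l < \<epsilon>))"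

end

theory Submission
  imports Defs
begin

text \<open>Let \<open>g = F + r0 N\<close> be the focal map. Every tangent vector of \<open>M\<close> is the sum of a round one, on which
  \<open>dN = - dF / r0\<close> and hence \<open>dg = 0\<close>, and a flat one, on which \<open>dN = 0\<close> and hence \<open>dg = dF\<close>
  (\<open>tangent_space_facts\<close>, \<open>principal_space_iff\<close>); the two kinds are orthogonal because
  the second fundamental form is symmetric. So the image of \<open>dg\<close> has
  dimension \<open>n - m\<close> and is orthogonal to \<open>N\<close> and to the image of \<open>dN\<close>. The main point is that this image is the
  same space \<open>V\<close> at all points. Differentiating \<open>dg X \<bullet> dN Y = 0\<close> and using the symmetry of the second
  derivatives of \<open>g\<close> and \<open>N\<close>, one finds a totally symmetric trilinear form that vanishes when an argument is
  round or flat, hence vanishes (\<open>D2_g_D_\<nu>_zero\<close>). Therefore the derivative of \<open>dg\<close> stays in the image of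
  \<open>dg\<close>, which is then constant by a Gronwall argument on a connected domain (\<open>D_g_in_V\<close>).

  It follows that \<open>g\<close> maps into an affine space \<open>c + V\<close> and \<open>N\<close> into the unit sphere of the complement of
  \<open>V\<close>, so that \<open>F = g - r0 N\<close> maps into the cylinder of radius \<open>r0\<close> around \<open>c + V\<close>; for \<open>m = n\<close> this is a
  sphere with centre \<open>c\<close>. The map \<open>F\<close> is onto this cylinder because it is a local isometry defined on a closed
  set (\<open>cylinder_step\<close>, \<open>image_F\<close>).

  The parallel map \<open>F + \<mu> N = g - (r0 - \<mu>) N\<close> has the principal curvatures \<open>1 / (r0 - \<mu>)\<close> and 0 with the
  same principal spaces, up to the choice of the normal (\<open>mean_curvature_F'\<close>). The flow equation becomes
  the linear equation \<open>\<mu>' = - (r0 - \<mu>) / m\<close>, whose solution with \<open>\<mu> 0 = 0\<close> is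
  \<open>r0 - \<mu> t = r0 exp (t / m)\<close>. This gives existence for all times, uniqueness, the images, which are cylinders of
  radius \<open>r0 exp (t / m)\<close>, and their collapse to the axis (\<open>flow_solution\<close>, \<open>flow_unique\<close>, \<open>image_flow\<close>,
  \<open>flow_collapse\<close>).

  No charts of \<open>M\<close> are used: all maps are extended to an open set by a smooth retraction onto \<open>M\<close>.\<close>

section \<open>Functions with continuous derivatives up to a given order\<close>

abbreviation D :: "('a::euclidean_space \<Rightarrow> 'b::euclidean_space) \<Rightarrow> 'a \<Rightarrow> 'a \<Rightarrow> 'b" where
  "D f p \<equiv> frechet_derivative f (at p)"

lemma D_eqI: "(f has_derivative f') (at p) \<Longrightarrow> D f p = f'"
  using frechet_derivative_at by metis

lemma Ck_on_subset: "Ck_on k U f \<Longrightarrow> V \<subseteq> U \<Longrightarrow> Ck_on k V f"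
proof (induction k arbitrary: f)
  case 0
  then show ?case by (auto intro: continuous_on_subset)
next
  case (Suc k)
  then show ?case by (auto intro: differentiable_on_subset)
qed

lemma Ck_on_differentiable:
  "Ck_on (Suc k) U f \<Longrightarrow> open U \<Longrightarrow> x \<in> U \<Longrightarrow> f differentiable (at x)"
  by (simp add: differentiable_on_eq_differentiable_at)

lemma Ck_on_cong:
  "open U \<Longrightarrow> (\<And>x. x \<in> U \<Longrightarrow> f x = g x) \<Longrightarrow> Ck_on k U f \<Longrightarrow> Ck_on k U g"
proof (induction k arbitrary: f g)
  case 0
  then show ?case by (simp cong: continuous_on_cong)
next
  case (Suc k)
  have der: "(g has_derivative D f x) (at x)" if "x \<in> U" for x
  proof -
    have "(f has_derivative D f x) (at x)"
      using Ck_on_differentiable[OF Suc.prems(3,1) that] frechet_derivative_works by blast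
    then show ?thesis
      by (rule has_derivative_transform_within_open[OF _ Suc.prems(1) that Suc.prems(2)])
  qed
  have "Ck_on k U (\<lambda>x. D g x v)" for v
    by (rule Suc.IH[OF Suc.prems(1), of "\<lambda>x. D f x v"]) (use Suc.prems(3) in \<open>simp_all add: D_eqI[OF der]\<close>)
  moreover have "g differentiable_on U"
    using der Suc.prems(1) by (auto simp: differentiable_on_eq_differentiable_at differentiable_def)
  ultimately show ?case by simp
qed

lemma Ck_on_derivI:
  assumes "open U" and "\<And>x. x \<in> U \<Longrightarrow> (f has_derivative f' x) (at x)"
    and "\<And>v. Ck_on k U (\<lambda>x. f' x v)"
  shows "Ck_on (Suc k) U f"
proof -
  have "f differentiable_on U"
    using assms(1,2) by (auto simp: differentiable_on_eq_differentiable_at differentiable_def)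
  moreover have "Ck_on k U (\<lambda>x. D f x v)" for v
    by (rule Ck_on_cong[OF assms(1) _ assms(3)[of v]]) (simp add: D_eqI[OF assms(2)])
  ultimately show ?thesis by simp
qed

lemma Ck_on_has_derivative:
  "Ck_on (Suc k) U f \<Longrightarrow> open U \<Longrightarrow> x \<in> U \<Longrightarrow> (f has_derivative D f x) (at x)"
  using Ck_on_differentiable frechet_derivative_works by blast

lemma Ck_on_SucD: "Ck_on (Suc k) U f \<Longrightarrow> Ck_on k U f"
proof (induction k arbitrary: f)
  case 0
  then show ?case by (auto intro: differentiable_imp_continuous_on)
next
  case (Suc k)
  then show ?case by auto
qed

lemma Ck_on_const: "Ck_on k U (\<lambda>x. c)"
  by (induction k arbitrary: c) (auto intro: differentiable_on_const)

lemma Ck_on_local: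
  assumes "open S" "\<And>p. p \<in> S \<Longrightarrow> \<exists>U. open U \<and> p \<in> U \<and> Ck_on k U f"
  shows "Ck_on k S f"
  using assms(2)
proof (induction k arbitrary: f)
  case 0
  have "isCont f p" if "p \<in> S" for p
    using 0[OF that] continuous_on_eq_continuous_at by auto
  then show ?case by (auto intro: continuous_at_imp_continuous_on)
next
  case (Suc k)
  have "f differentiable (at p)" if "p \<in> S" for p
    using Suc.prems[OF that] Ck_on_differentiable by blast
  moreover have "Ck_on k S (\<lambda>x. D f x v)" for v
    by (rule Suc.IH) (use Suc.prems in fastforce)
  ultimately show ?case
    by (auto simp: differentiable_on_eq_differentiable_at assms(1))
qed

lemma Ck_on_add:
  assumes "open U"
  shows "Ck_on k U f \<Longrightarrow> Ck_on k U g \<Longrightarrow> Ck_on k U (\<lambda>x. f x + g x)"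
proof (induction k arbitrary: f g)
  case 0
  then show ?case by (auto intro: continuous_on_add)
next
  case (Suc k)
  show ?case
    by (rule Ck_on_derivI[OF assms has_derivative_add
          [OF Ck_on_has_derivative[OF Suc.prems(1) assms] Ck_on_has_derivative[OF Suc.prems(2) assms]]])
      (use Suc in auto)
qed

lemma Ck_on_sum:
  assumes "open U" "finite I" "\<And>i. i \<in> I \<Longrightarrow> Ck_on k U (f i)"
  shows "Ck_on k U (\<lambda>x. \<Sum>i\<in>I. f i x)"
  using assms(2,3) by (induction I rule: finite_induct) (auto intro: Ck_on_const Ck_on_add assms(1))

lemma Ck_on_bounded_linear:
  assumes "open U" "bounded_linear L"
  shows "Ck_on k U f \<Longrightarrow> Ck_on k U (\<lambda>x. L (f x))"
proof (induction k arbitrary: f)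
  case 0
  then show ?case using assms by (auto intro: bounded_linear.continuous_on)
next
  case (Suc k)
  show ?case
    by (rule Ck_on_derivI[OF assms(1) bounded_linear.has_derivative
          [OF assms(2) Ck_on_has_derivative[OF Suc.prems(1) assms(1)]]])
      (use Suc in auto)
qed

lemma Ck_on_linear:
  assumes "open U" "bounded_linear L"
  shows "Ck_on k U L"
proof -
  have "Ck_on k U (\<lambda>x. x)"
  proof (cases k)
    case (Suc j)
    show ?thesis unfolding Suc
      by (rule Ck_on_derivI[OF assms(1) has_derivative_ident]) (rule Ck_on_const)
  qed (auto intro: continuous_on_id)
  then show ?thesis using Ck_on_bounded_linear[OF assms] by blast
qed

lemma Ck_on_scaleR:
  assumes "open U"
  shows "Ck_on k U a \<Longrightarrow> Ck_on k U f \<Longrightarrow> Ck_on k U (\<lambda>x. a x *\<^sub>R f x)"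
proof (induction k arbitrary: a f)
  case 0
  then show ?case by (auto intro: continuous_on_scaleR)
next
  case (Suc k)
  show ?case
  proof (rule Ck_on_derivI[OF assms has_derivative_scaleR
        [OF Ck_on_has_derivative[OF Suc.prems(1) assms] Ck_on_has_derivative[OF Suc.prems(2) assms]]])
    fix v
    show "Ck_on k U (\<lambda>x. a x *\<^sub>R D f x v + D a x v *\<^sub>R f x)"
      using Suc.prems Ck_on_SucD[OF Suc.prems(1)] Ck_on_SucD[OF Suc.prems(2)]
      by (intro Ck_on_add Suc.IH assms) auto
  qed
qed

text \<open>The chain rule expresses the derivative of \<open>f \<circ> r\<close> in a direction \<open>v\<close> through directional
  derivatives along directions \<open>r'(x) v\<close> that vary with \<open>x\<close>. Expanding them in the standard basis turns it
  into a sum of products to which the induction hypothesis applies.\<close>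

lemma Ck_on_compose:
  assumes "open U" "open V" "r ` V \<subseteq> U"
  shows "Ck_on k V r \<Longrightarrow> Ck_on k U f \<Longrightarrow> Ck_on k V (\<lambda>x. f (r x))"
proof (induction k arbitrary: f)
  case 0
  then show ?case using continuous_on_compose2 assms(3) by auto
next
  case (Suc k)
  have der: "((\<lambda>x. f (r x)) has_derivative (\<lambda>v. D f (r x) (D r x v))) (at x)" if "x \<in> V" for x
    using has_derivative_compose[OF Ck_on_has_derivative[OF Suc.prems(1) assms(2) that]
        Ck_on_has_derivative[OF Suc.prems(2) assms(1), of "r x"]] assms(3) that by auto
  have exp: "D f (r x) (D r x v) = (\<Sum>i\<in>Basis. (D r x v \<bullet> i) *\<^sub>R D f (r x) i)" if "x \<in> V" for x v
  proof -
    have "linear (D f (r x))"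
      using Ck_on_differentiable[OF Suc.prems(2) assms(1), of "r x"] assms(3) that
      by (auto intro: linear_frechet_derivative)
    then have "D f (r x) (\<Sum>i\<in>Basis. (D r x v \<bullet> i) *\<^sub>R i) = (\<Sum>i\<in>Basis. (D r x v \<bullet> i) *\<^sub>R D f (r x) i)"
      by (simp add: linear_sum linear_cmul)
    then show ?thesis by (simp add: euclidean_representation)
  qed
  show ?case
  proof (rule Ck_on_derivI[OF assms(2) der])
    fix v
    have "Ck_on k V (\<lambda>x. D r x v)" "Ck_on k V r" for v
      using Suc.prems(1) Ck_on_SucD by auto
    then have "Ck_on k V (\<lambda>x. \<Sum>i\<in>Basis. (D r x v \<bullet> i) *\<^sub>R D f (r x) i)"
      using Suc.prems(2)
      by (intro Ck_on_sum Ck_on_scaleR Suc.IH assms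
          Ck_on_bounded_linear[OF _ bounded_linear_inner_left]) auto
    then show "Ck_on k V (\<lambda>x. D f (r x) (D r x v))"
      by (rule Ck_on_cong[OF assms(2), rotated]) (simp add: exp)
  qed simp
qed

lemma open_nonzero: "open {x::'a::euclidean_space. x \<noteq> 0}"
  by (simp add: open_Collect_neq)

text \<open>The powers \<open>1/|x|^j\<close> are treated for all \<open>j\<close> at once because differentiation raises the exponent:
  the derivative of \<open>1/|x|^j\<close> is \<open>- j 1/|x|^(j+2)\<close> times a linear function.\<close>

lemma Ck_on_inverse_norm_power:
  "Ck_on k {x::'a::euclidean_space. x \<noteq> 0} (\<lambda>x. inverse (norm x) ^ j)"
proof (induction k arbitrary: j)
  case 0
  show ?case by (auto intro!: continuous_intros)
next
  case (Suc k)
  have der: "((\<lambda>x. inverse (norm x) ^ j) has_derivative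
      (\<lambda>v. inverse (norm x) ^ (j + 2) *\<^sub>R (- real j * (x \<bullet> v)))) (at x)"
    if "x \<in> {x. x \<noteq> 0}" for x :: 'a
  proof -
    have x: "x \<noteq> 0" using that by simp
    have "((\<lambda>x. inverse (norm x)) has_derivative
        (\<lambda>v. - (inverse (norm x) * (v \<bullet> sgn x) * inverse (norm x)))) (at x)"
      using Deriv.has_derivative_inverse[OF _ has_derivative_norm[OF x]] x by simp
    from has_derivative_power[OF this, of j] show ?thesis
      by (rule has_derivative_eq_rhs)
        (use x in \<open>cases j; simp add: fun_eq_iff sgn_div_norm inner_commute field_simps\<close>)
  qed
  have "Ck_on k {x. x \<noteq> 0} (\<lambda>x::'a. - real j * (x \<bullet> v))" for v
    by (intro Ck_on_linear open_nonzero bounded_linear_const_mult bounded_linear_inner_left)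
  then show ?case
    by (intro Ck_on_derivI[OF open_nonzero der] Ck_on_scaleR Suc.IH open_nonzero) auto
qed

section \<open>Symmetry of second derivatives\<close>

text \<open>Apply the mean value theorem first in the direction \<open>X\<close> to the function \<open>x \<mapsto> \<phi> (x + h Z) - \<phi> x\<close>
  and then in the direction \<open>Z\<close> to the derivative. The second difference is symmetric in \<open>X\<close> and \<open>Z\<close>, which
  is what makes the second derivatives agree in the limit \<open>h \<longrightarrow> 0\<close>.\<close>

lemma second_difference_mean_value:
  fixes \<phi> :: "'a::euclidean_space \<Rightarrow> real"
  assumes C2: "Ck_on 2 U \<phi>" and U: "open U" and h: "h > 0"
    and par: "\<And>s t. \<lbrakk>0 \<le> s; s \<le> h; 0 \<le> t; t \<le> h\<rbrakk> \<Longrightarrow> p + s *\<^sub>R X + t *\<^sub>R Z \<in> U"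
  shows "\<exists>s t. 0 < s \<and> s < h \<and> 0 < t \<and> t < h \<and>
     \<phi> (p + h *\<^sub>R X + h *\<^sub>R Z) - \<phi> (p + h *\<^sub>R X) - \<phi> (p + h *\<^sub>R Z) + \<phi> p =
     h * h * D (\<lambda>x. D \<phi> x X) (p + s *\<^sub>R X + t *\<^sub>R Z) Z"
proof -
  have C2': "Ck_on (Suc (Suc 0)) U \<phi>" using C2 by (simp add: numeral_2_eq_2)
  have d1: "(\<phi> has_derivative D \<phi> x) (at x)" if "x \<in> U" for x
    using Ck_on_has_derivative[OF C2' U that] .
  have d2: "((\<lambda>x. D \<phi> x X) has_derivative D (\<lambda>x. D \<phi> x X) x) (at x)" if "x \<in> U" for x
    using Ck_on_has_derivative[of 0 U "\<lambda>x. D \<phi> x X", OF _ U that] C2' by auto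
  have lin: "linear (D \<phi> x)" "linear (D (\<lambda>x. D \<phi> x X) x)" if "x \<in> U" for x
    using d1[OF that] d2[OF that] has_derivative_linear by blast+
  have s1: "((\<lambda>s. \<phi> (p + s *\<^sub>R X + t *\<^sub>R Z)) has_real_derivative D \<phi> (p + s *\<^sub>R X + t *\<^sub>R Z) X) (at s)"
    if "0 \<le> s" "s \<le> h" "0 \<le> t" "t \<le> h" for s t
  proof -
    have "((\<lambda>s. \<phi> (p + s *\<^sub>R X + t *\<^sub>R Z)) has_derivative (\<lambda>u. D \<phi> (p + s *\<^sub>R X + t *\<^sub>R Z) (u *\<^sub>R X))) (at s)"
      by (rule has_derivative_compose[where f="\<lambda>s. p + s *\<^sub>R X + t *\<^sub>R Z", OF _ d1[OF par[OF that]]]) (auto intro!: derivative_eq_intros)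
    then show ?thesis
      using lin[OF par[OF that]] by (simp add: has_field_derivative_def linear_cmul mult_commute_abs)
  qed
  have s2: "((\<lambda>t. D \<phi> (p + s *\<^sub>R X + t *\<^sub>R Z) X) has_real_derivative
       D (\<lambda>x. D \<phi> x X) (p + s *\<^sub>R X + t *\<^sub>R Z) Z) (at t)"
    if "0 \<le> s" "s \<le> h" "0 \<le> t" "t \<le> h" for s t
  proof -
    have "((\<lambda>t. D \<phi> (p + s *\<^sub>R X + t *\<^sub>R Z) X) has_derivative
        (\<lambda>u. D (\<lambda>x. D \<phi> x X) (p + s *\<^sub>R X + t *\<^sub>R Z) (u *\<^sub>R Z))) (at t)"
      by (rule has_derivative_compose[where f="\<lambda>t. p + s *\<^sub>R X + t *\<^sub>R Z", OF _ d2[OF par[OF that]]]) (auto intro!: derivative_eq_intros)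
    then show ?thesis
      using lin[OF par[OF that]] by (simp add: has_field_derivative_def linear_cmul mult_commute_abs)
  qed
  have "\<exists>s. 0 < s \<and> s < h \<and>
    (\<phi> (p + h *\<^sub>R X + h *\<^sub>R Z) - \<phi> (p + h *\<^sub>R X + 0 *\<^sub>R Z)) - (\<phi> (p + 0 *\<^sub>R X + h *\<^sub>R Z) - \<phi> (p + 0 *\<^sub>R X + 0 *\<^sub>R Z))
    = (h - 0) * (D \<phi> (p + s *\<^sub>R X + h *\<^sub>R Z) X - D \<phi> (p + s *\<^sub>R X + 0 *\<^sub>R Z) X)"
    using h by (intro MVT2 DERIV_diff s1) auto
  then obtain s where s: "0 < s" "s < h" and es:
    "(\<phi> (p + h *\<^sub>R X + h *\<^sub>R Z) - \<phi> (p + h *\<^sub>R X + 0 *\<^sub>R Z)) - (\<phi> (p + 0 *\<^sub>R X + h *\<^sub>R Z) - \<phi> (p + 0 *\<^sub>R X + 0 *\<^sub>R Z))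
    = (h - 0) * (D \<phi> (p + s *\<^sub>R X + h *\<^sub>R Z) X - D \<phi> (p + s *\<^sub>R X + 0 *\<^sub>R Z) X)" by blast
  have "\<exists>t. 0 < t \<and> t < h \<and> D \<phi> (p + s *\<^sub>R X + h *\<^sub>R Z) X - D \<phi> (p + s *\<^sub>R X + 0 *\<^sub>R Z) X =
     (h - 0) * D (\<lambda>x. D \<phi> x X) (p + s *\<^sub>R X + t *\<^sub>R Z) Z"
    using h s by (intro MVT2 s2) auto
  then obtain t where "0 < t" "t < h" and et: "D \<phi> (p + s *\<^sub>R X + h *\<^sub>R Z) X - D \<phi> (p + s *\<^sub>R X + 0 *\<^sub>R Z) X =
     (h - 0) * D (\<lambda>x. D \<phi> x X) (p + s *\<^sub>R X + t *\<^sub>R Z) Z" by blast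
  with s es show ?thesis by (intro exI[of _ s] exI[of _ t]) (simp add: algebra_simps)
qed

lemma second_derivative_symmetric_real:
  fixes \<phi> :: "'a::euclidean_space \<Rightarrow> real"
  assumes C2: "Ck_on 2 U \<phi>" and U: "open U" and p: "p \<in> U"
  shows "D (\<lambda>x. D \<phi> x X) p Z = D (\<lambda>x. D \<phi> x Z) p X"
proof (rule ccontr)
  define A where "A = (\<lambda>x. D (\<lambda>x. D \<phi> x X) x Z)"
  define B where "B = (\<lambda>x. D (\<lambda>x. D \<phi> x Z) x X)"
  assume "D (\<lambda>x. D \<phi> x X) p Z \<noteq> D (\<lambda>x. D \<phi> x Z) p X"
  then have e: "\<bar>A p - B p\<bar> / 2 > 0" (is "?e > 0") by (simp add: A_def B_def)
  have cont: "continuous_on U A" "continuous_on U B"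
    using C2 by (auto simp: A_def B_def numeral_2_eq_2)
  then have cA: "isCont A p" and cB: "isCont B p"
    using U p continuous_on_eq_continuous_at by blast+
  obtain d1 where d1: "d1 > 0" "\<And>x. dist x p < d1 \<Longrightarrow> dist (A x) (A p) < ?e"
    using cA e unfolding continuous_at_eps_delta by blast
  obtain d2 where d2: "d2 > 0" "\<And>x. dist x p < d2 \<Longrightarrow> dist (B x) (B p) < ?e"
    using cB e unfolding continuous_at_eps_delta by blast
  obtain d3 where d3: "d3 > 0" "ball p d3 \<subseteq> U" using U p open_contains_ball by blast
  define d where "d = min d1 (min d2 d3)"
  have dpos: "d > 0" using d1 d2 d3 by (simp add: d_def)
  \<comment> \<open>small enough for the parallelogram spanned by \<open>h X\<close> and \<open>h Z\<close> at \<open>p\<close> to lie in the ball of radius \<open>d\<close>\<close>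
  define h where "h = d / (norm X + norm Z + 1)"
  have hpos: "h > 0" using dpos by (simp add: h_def add_nonneg_pos)
  have small: "dist (p + s *\<^sub>R X + t *\<^sub>R Z) p < d" if "0 \<le> s" "s \<le> h" "0 \<le> t" "t \<le> h" for s t
  proof -
    have "dist (p + s *\<^sub>R X + t *\<^sub>R Z) p \<le> s * norm X + t * norm Z"
      using that norm_triangle_ineq[of "s *\<^sub>R X" "t *\<^sub>R Z"] by (simp add: dist_norm)
    also have "\<dots> \<le> h * norm X + h * norm Z"
      using that by (intro add_mono mult_right_mono) auto
    also have "\<dots> < h * (norm X + norm Z + 1)" using hpos by (simp add: algebra_simps)
    also have "\<dots> = d" 
    proof -
      have "norm X + norm Z + 1 > 0" by (simp add: add_nonneg_pos)
      then show ?thesis by (simp add: h_def)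
    qed
    finally show ?thesis .
  qed
  have inU: "p + s *\<^sub>R X + t *\<^sub>R Z \<in> U" if "0 \<le> s" "s \<le> h" "0 \<le> t" "t \<le> h" for s t
    using small[OF that] d3 by (auto simp: d_def dist_commute subset_iff)
  obtain s t where st: "0 < s" "s < h" "0 < t" "t < h"
    "\<phi> (p + h *\<^sub>R X + h *\<^sub>R Z) - \<phi> (p + h *\<^sub>R X) - \<phi> (p + h *\<^sub>R Z) + \<phi> p = h * h * A (p + s *\<^sub>R X + t *\<^sub>R Z)"
    using second_difference_mean_value[OF C2 U hpos inU] unfolding A_def by blast
  have inU': "p + s *\<^sub>R Z + t *\<^sub>R X \<in> U" if "0 \<le> s" "s \<le> h" "0 \<le> t" "t \<le> h" for s t
    using inU[OF that(3,4,1,2)] by (simp add: algebra_simps)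
  obtain s' t' where st': "0 < s'" "s' < h" "0 < t'" "t' < h"
    "\<phi> (p + h *\<^sub>R Z + h *\<^sub>R X) - \<phi> (p + h *\<^sub>R Z) - \<phi> (p + h *\<^sub>R X) + \<phi> p = h * h * B (p + s' *\<^sub>R Z + t' *\<^sub>R X)"
    using second_difference_mean_value[OF C2 U hpos inU'] unfolding B_def by blast
  have "h * h * A (p + s *\<^sub>R X + t *\<^sub>R Z) = h * h * B (p + t' *\<^sub>R X + s' *\<^sub>R Z)"
    using st(5) st'(5) by (simp add: algebra_simps)
  then have "A (p + s *\<^sub>R X + t *\<^sub>R Z) = B (p + t' *\<^sub>R X + s' *\<^sub>R Z)"
    using hpos by simp
  moreover have "dist (A (p + s *\<^sub>R X + t *\<^sub>R Z)) (A p) < ?e"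
    using small[of s t] st by (intro d1 d2) (auto simp: d_def)
  moreover have "dist (B (p + t' *\<^sub>R X + s' *\<^sub>R Z)) (B p) < ?e"
    using small[of t' s'] st' by (intro d1 d2) (auto simp: d_def)
  ultimately show False unfolding dist_real_def by (smt (verit, best) field_sum_of_halves)
qed

lemma second_derivative_symmetric:
  fixes f :: "'a::euclidean_space \<Rightarrow> 'b::euclidean_space"
  assumes C2: "Ck_on 2 U f" and U: "open U" and p: "p \<in> U"
  shows "D (\<lambda>x. D f x X) p Z = D (\<lambda>x. D f x Z) p X"
proof (rule euclidean_eqI)
  fix i :: 'b assume "i \<in> Basis"
  have C2': "Ck_on (Suc (Suc 0)) U f" using C2 by (simp add: numeral_2_eq_2)
  have d1: "D (\<lambda>x. f x \<bullet> i) x = (\<lambda>v. D f x v \<bullet> i)" if "x \<in> U" for x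
    by (rule D_eqI) (intro has_derivative_inner_left Ck_on_has_derivative[OF C2' U that])
  have d2: "D (\<lambda>x. D (\<lambda>x. f x \<bullet> i) x Y) p = (\<lambda>v. D (\<lambda>x. D f x Y) p v \<bullet> i)" for Y
  proof (rule D_eqI)
    have "Ck_on (Suc 0) U (\<lambda>x. D f x Y)" using C2' by simp
    then have "((\<lambda>x. D f x Y \<bullet> i) has_derivative (\<lambda>v. D (\<lambda>x. D f x Y) p v \<bullet> i)) (at p)"
      by (intro has_derivative_inner_left Ck_on_has_derivative[OF _ U p])
    then show "((\<lambda>x. D (\<lambda>x. f x \<bullet> i) x Y) has_derivative (\<lambda>v. D (\<lambda>x. D f x Y) p v \<bullet> i)) (at p)"
      by (rule has_derivative_transform_within_open[OF _ U p]) (simp add: d1)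
  qed
  show "D (\<lambda>x. D f x X) p Z \<bullet> i = D (\<lambda>x. D f x Z) p X \<bullet> i"
    using second_derivative_symmetric_real[OF Ck_on_bounded_linear[OF U bounded_linear_inner_left C2] U p, of i X Z]
    by (simp add: d2)
qed

section \<open>Submanifolds as smooth retracts\<close>

text \<open>A derivative within \<open>M\<close> is a linear map on the ambient space, but on a tangent vector its value is
  the velocity of the image of a curve and hence does not depend on the choice.\<close>

lemma has_derivative_within_unique_tangent:
  assumes "(F has_derivative F1) (at x within M)" "(F has_derivative F2) (at x within M)"
    and "v \<in> tangent_space M x"
  shows "F1 v = F2 v"
proof -
  obtain \<gamma> :: "real \<Rightarrow> 'a" where \<gamma>: "\<gamma> 0 = x" "\<forall>\<^sub>F s in nhds 0. \<gamma> s \<in> M"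
    "(\<gamma> has_vector_derivative v) (at 0)"
    using assms(3) by (auto simp: tangent_space_def)
  obtain S where S: "open S" "0 \<in> S" "\<gamma> ` S \<subseteq> M"
    using \<gamma>(2) unfolding eventually_nhds by blast
  have "((\<lambda>s. F (\<gamma> s)) has_vector_derivative G v) (at 0)"
    if "(F has_derivative G) (at x within M)" for G
  proof -
    have "(\<gamma> has_derivative (\<lambda>s. s *\<^sub>R v)) (at 0 within S)"
      using \<gamma>(3) by (auto simp: has_vector_derivative_def intro: has_derivative_at_withinI)
    moreover have "(F has_derivative G) (at (\<gamma> 0) within \<gamma> ` S)"
      using has_derivative_subset[OF that S(3)] \<gamma>(1) by simp
    ultimately have "((\<lambda>s. F (\<gamma> s)) has_derivative (\<lambda>s. G (s *\<^sub>R v))) (at 0 within S)"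
      by (rule has_derivative_in_compose)
    then show ?thesis
      using S at_within_open[of 0 S] has_derivative_linear[OF that]
      by (simp add: has_vector_derivative_def linear_cmul)
  qed
  from this[OF assms(1)] this[OF assms(2)] show ?thesis
    by (rule vector_derivative_unique_at)
qed

lemma differential_eqI:
  assumes "(F has_derivative F') (at x within M)" "v \<in> tangent_space M x"
  shows "differential M F x v = F' v"
  using has_derivative_within_unique_tangent[OF _ assms] assms(1)
  by (meson differentiableI frechet_derivative_works)

text \<open>A smooth retraction \<open>\<rho>\<close> of an open set \<open>\<Omega>\<close> onto \<open>M\<close> replaces charts: a map \<open>F\<close> on \<open>M\<close> is studied
  through \<open>F \<circ> \<rho>\<close>, which is an ordinary function on \<open>\<Omega>\<close> with ordinary, commuting second derivatives.\<close>

locale smooth_retract =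
  fixes M \<Omega> :: "'e::euclidean_space set" and \<rho> :: "'e \<Rightarrow> 'e"
  assumes open_\<Omega>: "open \<Omega>" and M_sub: "M \<subseteq> \<Omega>"
    and smooth_\<rho>: "Ck_on k \<Omega> \<rho>"
    and \<rho>_in: "p \<in> \<Omega> \<Longrightarrow> \<rho> p \<in> M"
    and \<rho>_id: "x \<in> M \<Longrightarrow> \<rho> x = x"
begin

lemma M_\<Omega>: "x \<in> M \<Longrightarrow> x \<in> \<Omega>" using M_sub by blast

lemma D_\<rho>: "p \<in> \<Omega> \<Longrightarrow> (\<rho> has_derivative D \<rho> p) (at p)"
  using Ck_on_has_derivative[OF smooth_\<rho> open_\<Omega>] .

lemma D_\<rho>_tangent:
  assumes "p \<in> \<Omega>"
  shows "D \<rho> p X \<in> tangent_space M (\<rho> p)"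
proof -
  have "open ((\<lambda>s::real. p + s *\<^sub>R X) -` \<Omega>)"
    by (intro open_vimage open_\<Omega> continuous_intros)
  then have "\<forall>\<^sub>F s::real in nhds 0. p + s *\<^sub>R X \<in> \<Omega>"
    unfolding eventually_nhds using assms by (intro exI[of _ "(\<lambda>s. p + s *\<^sub>R X) -` \<Omega>"]) auto
  then have "\<forall>\<^sub>F s::real in nhds 0. \<rho> (p + s *\<^sub>R X) \<in> M"
    by (rule eventually_mono) (rule \<rho>_in)
  moreover have "((\<lambda>s. \<rho> (p + s *\<^sub>R X)) has_derivative (\<lambda>s. D \<rho> p (s *\<^sub>R X))) (at 0)"
    by (rule has_derivative_compose[where f="\<lambda>s. p + s *\<^sub>R X"])
      (auto intro!: derivative_eq_intros D_\<rho> assms)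
  then have "((\<lambda>s. \<rho> (p + s *\<^sub>R X)) has_vector_derivative D \<rho> p X) (at 0)"
    using has_derivative_linear[OF D_\<rho>[OF assms]] by (simp add: has_vector_derivative_def linear_cmul)
  ultimately show ?thesis
    unfolding tangent_space_def by (intro CollectI exI[of _ "\<lambda>s. \<rho> (p + s *\<^sub>R X)"]) simp
qed

lemma D_\<rho>_fix:
  assumes x: "x \<in> M" and v: "v \<in> tangent_space M x"
  shows "D \<rho> x v = v"
proof -
  have "((\<lambda>y. y) has_derivative D \<rho> x) (at x within M)"
    by (rule has_derivative_transform[OF x _ has_derivative_at_withinI[OF D_\<rho>[OF M_\<Omega>[OF x]]]])
      (simp add: \<rho>_id)
  from has_derivative_within_unique_tangent[OF this has_derivative_ident v] show ?thesis .
qed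

lemma tangent_space_eq: "x \<in> M \<Longrightarrow> tangent_space M x = range (D \<rho> x)"
  using D_\<rho>_fix D_\<rho>_tangent[OF M_\<Omega>] \<rho>_id by (auto simp: image_iff) metis

lemma subspace_tangent_space: "x \<in> M \<Longrightarrow> subspace (tangent_space M x)"
  using tangent_space_eq D_\<rho>[OF M_\<Omega>] has_derivative_linear linear_subspace_image subspace_UNIV
  by metis

lemma smooth_map_iff: "smooth_map M F \<longleftrightarrow> (\<forall>k. Ck_on k \<Omega> (\<lambda>p. F (\<rho> p)))"
proof
  assume F: "smooth_map M F"
  show "\<forall>k. Ck_on k \<Omega> (\<lambda>p. F (\<rho> p))"
  proof
    fix k
    show "Ck_on k \<Omega> (\<lambda>p. F (\<rho> p))"
    proof (rule Ck_on_local[OF open_\<Omega>])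
      fix p assume p: "p \<in> \<Omega>"
      obtain U h where U: "open U" "\<rho> p \<in> U" "Ck_on k U h" "\<And>y. y \<in> M \<inter> U \<Longrightarrow> h y = F y"
        using F \<rho>_in[OF p] unfolding smooth_map_def by metis
      define V where "V = \<Omega> \<inter> \<rho> -` U"
      have "continuous_on \<Omega> \<rho>" using smooth_\<rho>[of 0] by simp
      then have V: "open V" "p \<in> V" "\<rho> ` V \<subseteq> U" "V \<subseteq> \<Omega>"
        using continuous_open_preimage[OF _ open_\<Omega> U(1), of \<rho>] p U(2) by (auto simp: V_def)
      have "Ck_on k V (\<lambda>p. h (\<rho> p))"
        by (rule Ck_on_compose[OF U(1) V(1,3) Ck_on_subset[OF smooth_\<rho> V(4)] U(3)])
      then have "Ck_on k V (\<lambda>p. F (\<rho> p))"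
        by (rule Ck_on_cong[OF V(1), rotated]) (use U(4) \<rho>_in V in auto)
      then show "\<exists>U. open U \<and> p \<in> U \<and> Ck_on k U (\<lambda>p. F (\<rho> p))"
        using V by blast
    qed
  qed
next
  assume F: "\<forall>k. Ck_on k \<Omega> (\<lambda>p. F (\<rho> p))"
  then show "smooth_map M F"
    unfolding smooth_map_def using open_\<Omega> M_sub \<rho>_id
    by (intro ballI exI[of _ \<Omega>] exI[of _ "\<lambda>p. F (\<rho> p)"]) auto
qed

lemma has_derivative_within_M:
  assumes "\<And>k. Ck_on k \<Omega> (\<lambda>p. F (\<rho> p))" and x: "x \<in> M"
  shows "(F has_derivative D (\<lambda>p. F (\<rho> p)) x) (at x within M)"
  by (rule has_derivative_transform[OF x _
        has_derivative_at_withinI[OF Ck_on_has_derivative[OF assms(1) open_\<Omega> M_\<Omega>[OF x]]]])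
    (simp add: \<rho>_id)

lemma differential_eq:
  assumes "\<And>k. Ck_on k \<Omega> (\<lambda>p. F (\<rho> p))" "x \<in> M" "v \<in> tangent_space M x"
  shows "differential M F x v = D (\<lambda>p. F (\<rho> p)) x v"
  by (rule differential_eqI[OF has_derivative_within_M[OF assms(1,2)] assms(3)])

text \<open>Since \<open>F \<circ> \<rho> = (F \<circ> \<rho>) \<circ> \<rho>\<close>, every first order identity that holds on \<open>M\<close> holds on the open set
  \<open>\<Omega>\<close>, where it can be differentiated in all directions.\<close>

lemma D_retract:
  assumes "\<And>k. Ck_on k \<Omega> (\<lambda>p. F (\<rho> p))" "p \<in> \<Omega>"
  shows "D (\<lambda>p. F (\<rho> p)) p X = D (\<lambda>p. F (\<rho> p)) (\<rho> p) (D \<rho> p X)"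
proof -
  note d = Ck_on_has_derivative[OF assms(1) open_\<Omega>]
  have "((\<lambda>p. F (\<rho> (\<rho> p))) has_derivative (\<lambda>X. D (\<lambda>p. F (\<rho> p)) (\<rho> p) (D \<rho> p X))) (at p)"
    by (rule has_derivative_compose[OF D_\<rho>[OF assms(2)] d]) (use \<rho>_in assms M_\<Omega> in auto)
  then have "((\<lambda>p. F (\<rho> p)) has_derivative (\<lambda>X. D (\<lambda>p. F (\<rho> p)) (\<rho> p) (D \<rho> p X))) (at p)"
    by (rule has_derivative_transform_within_open[OF _ open_\<Omega> assms(2)]) (simp add: \<rho>_in \<rho>_id)
  then show ?thesis using D_eqI by metis
qed

end

section \<open>Hypersurfaces with a round and a flat principal curvature\<close>

text \<open>The domain is only required to be a closed set with a smooth retraction of a connected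
  neighbourhood. The multiplicity \<open>d\<close> of the curvature 0 is prescribed for \<open>d > 0\<close> only, as in the case
  of a sphere; for \<open>d = 0\<close> it follows from the dimension.\<close>

locale cylindrical_immersion = smooth_retract M \<Omega> \<rho>
  for M \<Omega> :: "'e::euclidean_space set" and \<rho> +
  fixes F N :: "'e \<Rightarrow> 'a::euclidean_space" and r0 :: real and m d :: nat
  assumes closed_M: "closed M" and M_nonempty: "M \<noteq> {}" and connected_\<Omega>: "connected \<Omega>"
    and isometric: "isometric_immersion M F"
    and normal: "unit_normal_field M F N"
    and r0_pos: "r0 > 0" and m_pos: "m > 0" and DIM_a: "DIM('a) = m + d + 1"
    and dim_round: "x \<in> M \<Longrightarrow> dim (principal_space M F N x (1 / r0)) = m"
    and dim_flat: "x \<in> M \<Longrightarrow> d > 0 \<Longrightarrow> dim (principal_space M F N x 0) = d"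
begin

text \<open>In what follows \<open>f\<close> and \<open>\<nu>\<close> are the extensions of \<open>F\<close> and \<open>N\<close> to \<open>\<Omega>\<close> that are constant on the fibres
  of \<open>\<rho>\<close>.\<close>

definition f where "f p = F (\<rho> p)"
definition \<nu> where "\<nu> p = N (\<rho> p)"

lemma f_smooth: "Ck_on k \<Omega> f" and \<nu>_smooth: "Ck_on k \<Omega> \<nu>"
  using isometric normal smooth_map_iff
  unfolding isometric_immersion_def immersion_def unit_normal_field_def f_def[abs_def] \<nu>_def[abs_def] by blast+

lemma f_der: "p \<in> \<Omega> \<Longrightarrow> (f has_derivative D f p) (at p)"
  and \<nu>_der: "p \<in> \<Omega> \<Longrightarrow> (\<nu> has_derivative D \<nu> p) (at p)"
  using Ck_on_has_derivative[OF f_smooth open_\<Omega>] Ck_on_has_derivative[OF \<nu>_smooth open_\<Omega>] by blast+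

lemma f_lin: "p \<in> \<Omega> \<Longrightarrow> linear (D f p)" and \<nu>_lin: "p \<in> \<Omega> \<Longrightarrow> linear (D \<nu> p)"
  using f_der \<nu>_der has_derivative_linear by blast+

lemma f_M: "x \<in> M \<Longrightarrow> f x = F x" and \<nu>_M: "x \<in> M \<Longrightarrow> \<nu> x = N x"
  by (simp_all add: f_def \<nu>_def \<rho>_id)

lemma differential_F: "x \<in> M \<Longrightarrow> v \<in> tangent_space M x \<Longrightarrow> differential M F x v = D f x v"
  and differential_N: "x \<in> M \<Longrightarrow> v \<in> tangent_space M x \<Longrightarrow> differential M N x v = D \<nu> x v"
  using differential_eq[of F x v] differential_eq[of N x v] f_smooth \<nu>_smooth
  by (simp_all add: f_def[abs_def] \<nu>_def[abs_def])

lemma f_retract: "p \<in> \<Omega> \<Longrightarrow> D f p X = D f (\<rho> p) (D \<rho> p X)"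
  and \<nu>_retract: "p \<in> \<Omega> \<Longrightarrow> D \<nu> p X = D \<nu> (\<rho> p) (D \<rho> p X)"
  using D_retract[of F p X] D_retract[of N p X] f_smooth \<nu>_smooth
  by (simp_all add: f_def[abs_def] \<nu>_def[abs_def])

lemma f_isometric:
  "x \<in> M \<Longrightarrow> v \<in> tangent_space M x \<Longrightarrow> w \<in> tangent_space M x \<Longrightarrow> D f x v \<bullet> D f x w = v \<bullet> w"
  using isometric unfolding isometric_immersion_def induced_metric_def by (simp add: differential_F)

lemma normal_f:
  assumes "p \<in> \<Omega>"
  shows "\<nu> p \<bullet> D f p X = 0"
proof -
  have "N (\<rho> p) \<bullet> D f (\<rho> p) (D \<rho> p X) = 0"
    using normal \<rho>_in[OF assms] D_\<rho>_tangent[OF assms] differential_F[of "\<rho> p"]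
    unfolding unit_normal_field_def by metis
  then show ?thesis using f_retract[OF assms] by (simp add: \<nu>_def)
qed

lemma \<nu>_unit: "p \<in> \<Omega> \<Longrightarrow> \<nu> p \<bullet> \<nu> p = 1"
  using normal \<rho>_in unfolding unit_normal_field_def \<nu>_def by (simp add: dot_square_norm)

text \<open>The product rule for an inner product that is constant on the neighbourhood: the device by which
  all second order relations below are obtained from first order ones.\<close>

lemma D_inner_const:
  assumes "p \<in> \<Omega>" "\<And>q. q \<in> \<Omega> \<Longrightarrow> a q \<bullet> b q = c"
    "(a has_derivative a') (at p)" "(b has_derivative b') (at p)"
  shows "a p \<bullet> b' X + a' X \<bullet> b p = 0"
proof -
  have "((\<lambda>q. a q \<bullet> b q) has_derivative (\<lambda>X. a p \<bullet> b' X + a' X \<bullet> b p)) (at p)"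
    by (rule has_derivative_inner assms)+
  moreover have "((\<lambda>q. a q \<bullet> b q) has_derivative (\<lambda>X. 0)) (at p)"
    by (rule has_derivative_transform_within_open[OF has_derivative_const[of c] open_\<Omega> assms(1)])
      (simp add: assms)
  ultimately show ?thesis by (metis (no_types, lifting) has_derivative_unique)
qed

lemma normal_\<nu>: "p \<in> \<Omega> \<Longrightarrow> \<nu> p \<bullet> D \<nu> p X = 0"
  using D_inner_const[OF _ \<nu>_unit \<nu>_der \<nu>_der, of p X] by (simp add: inner_commute)

lemma second_form:
  assumes "p \<in> \<Omega>"
  shows "D (\<lambda>q. D f q X) p Z \<bullet> \<nu> p = - (D \<nu> p Z \<bullet> D f p X)"
proof -
  have "Ck_on (Suc 0) \<Omega> (\<lambda>q. D f q X)" using f_smooth[of "Suc (Suc 0)"] by simp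
  note dX = Ck_on_has_derivative[OF this open_\<Omega> assms]
  have "\<nu> p \<bullet> D (\<lambda>q. D f q X) p Z + D \<nu> p Z \<bullet> D f p X = 0"
    by (rule D_inner_const[OF assms normal_f \<nu>_der[OF assms] dX])
  then show ?thesis by (simp add: inner_commute)
qed

text \<open>Differentiating \<open>\<nu> \<bullet> df Y = 0\<close> in the direction \<open>X\<close> identifies \<open>- (d\<nu> X \<bullet> df Y)\<close> with the normal part of the
  second derivative of \<open>f\<close>, which is symmetric.\<close>

lemma shape_symmetric:
  assumes "p \<in> \<Omega>"
  shows "D \<nu> p X \<bullet> D f p Y = D \<nu> p Y \<bullet> D f p X"
  using second_form[OF assms, of Y X] second_form[OF assms, of X Y]
    second_derivative_symmetric[OF f_smooth open_\<Omega> assms, of X Y] by simp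

definition round where "round x = principal_space M F N x (1 / r0)"
definition flat where "flat x = principal_space M F N x 0"

lemma principal_space_iff_form:
  assumes "x \<in> M"
  shows "v \<in> principal_space M F N x \<kappa> \<longleftrightarrow> v \<in> tangent_space M x \<and>
    (\<forall>w\<in>tangent_space M x. - (D \<nu> x v \<bullet> D f x w) = \<kappa> * (v \<bullet> w))"
  using assms unfolding principal_space_def second_fundamental_form_def induced_metric_def
  by (auto simp: differential_F differential_N f_isometric)

lemma subspace_principal:
  assumes x: "x \<in> M"
  shows "subspace (principal_space M F N x \<kappa>)"
proof -
  note T = subspace_tangent_space[OF x] and L = \<nu>_lin[OF M_\<Omega>[OF x]]
  show ?thesis
  proof (rule subspaceI)
    show "0 \<in> principal_space M F N x \<kappa>"
      using subspace_0[OF T] linear_0[OF L] by (simp add: principal_space_iff_form[OF x])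
    fix v w assume "v \<in> principal_space M F N x \<kappa>" "w \<in> principal_space M F N x \<kappa>"
    then show "v + w \<in> principal_space M F N x \<kappa>"
      using subspace_add[OF T] linear_add[OF L]
      by (simp add: principal_space_iff_form[OF x] inner_add_left distrib_left)
  next
    fix c v assume "v \<in> principal_space M F N x \<kappa>"
    then show "c *\<^sub>R v \<in> principal_space M F N x \<kappa>"
      using subspace_scale[OF T] linear_cmul[OF L]
      by (simp add: principal_space_iff_form[OF x] mult.left_commute[of \<kappa>] flip: mult_minus_right)
  qed
qed

lemma round_inter_flat:
  assumes x: "x \<in> M"
  shows "round x \<inter> flat x = {0}"
proof -
  have "v = 0" if "v \<in> round x" "v \<in> flat x" for v
  proof -
    have "v \<in> tangent_space M x" using that x by (simp add: round_def principal_space_iff_form)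
    then have "v \<bullet> v = 0"
      using that x r0_pos by (auto simp: round_def flat_def principal_space_iff_form)
    then show ?thesis by simp
  qed
  then show ?thesis
    using subspace_0[OF subspace_principal[OF x]] by (auto simp: round_def flat_def)
qed

text \<open>All three claims follow by counting dimensions, without computing the tangent space: it contains
  the direct sum of the two principal spaces, of dimension at least \<open>m + d\<close>, and \<open>df\<close> maps it injectively
  into the orthogonal complement of the normal, of dimension \<open>m + d\<close>.\<close>

lemma tangent_space_facts:
  assumes x: "x \<in> M"
  shows tangent_decomp: "{a + b |a b. a \<in> round x \<and> b \<in> flat x} = tangent_space M x" (is "?S = ?T")
    and D_f_onto: "D f x ` tangent_space M x = {u. N x \<bullet> u = 0}" (is "?I = ?H")
    and dim_flat_space: "dim (flat x) = d"
proof -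
  let ?A = "round x" and ?B = "flat x"
  have sub: "subspace ?A" "subspace ?B" "?A \<subseteq> ?T" "?B \<subseteq> ?T"
    using subspace_principal[OF x] x by (auto simp: round_def flat_def principal_space_iff_form)
  note T = subspace_tangent_space[OF x] and L = f_lin[OF M_\<Omega>[OF x]]
  have SsubT: "?S \<subseteq> ?T" using sub subspace_add[OF T] by blast
  have S: "subspace ?S" using subspace_sums[OF sub(1,2)] .
  have "dim ?S = dim ?A + dim ?B"
    using dim_sums_Int[OF sub(1,2)] round_inter_flat[OF x] by simp
  moreover have "dim ?A = m" using dim_round[OF x] by (simp add: round_def)
  ultimately have dSB: "dim ?S = m + dim ?B" by simp
  moreover have "dim ?B \<ge> d"
    using dim_flat[OF x] by (cases "d = 0") (auto simp: flat_def)
  ultimately have dS: "dim ?S \<ge> m + d" by simp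
  have inj: "inj_on (D f x) ?T"
  proof (rule inj_onI)
    fix v w assume vw: "v \<in> ?T" "w \<in> ?T" "D f x v = D f x w"
    then have "D f x (v - w) = 0" using L by (simp add: linear_diff)
    moreover have "v - w \<in> ?T" using vw T by (simp add: subspace_diff)
    ultimately have "(v - w) \<bullet> (v - w) = 0"
      using f_isometric[OF x, of "v - w" "v - w"] by simp
    then show "v = w" by simp
  qed
  have dI: "dim ?I = dim ?T"
    using dim_image_eq[OF L, of ?T] inj span_eq_iff[THEN iffD2, OF T] by simp
  have "N x \<noteq> 0" using normal x unfolding unit_normal_field_def by fastforce
  then have dH: "dim ?H = m + d" using dim_hyperplane[of "N x"] DIM_a by simp
  have IH: "?I \<subseteq> ?H" using normal_f[OF M_\<Omega>[OF x]] by (auto simp: \<nu>_M[OF x])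
  have subI: "subspace ?I" using linear_subspace_image[OF L T] .
  have subH: "subspace ?H" by (rule subspace_hyperplane)
  have dT: "dim ?T \<ge> dim ?S" using dim_subset[OF SsubT] .
  have dT2: "dim ?T \<le> m + d" using dim_subset[OF IH] dI dH by simp
  show "?S = ?T" by (rule subspace_dim_equal[OF S T SsubT]) (use dS dT2 in simp)
  show "dim ?B = d" using dSB dS dT dT2 by simp
  show "?I = ?H" by (rule subspace_dim_equal[OF subI subH IH]) (use dS dT dI dH in simp)
qed

text \<open>The defining equation of a principal vector only tests \<open>d\<nu> v + \<kappa> df v\<close> against tangent directions;
  since this vector is itself tangent to the hypersurface, it vanishes.\<close>

lemma principal_space_iff:
  assumes x: "x \<in> M"
  shows "v \<in> principal_space M F N x \<kappa> \<longleftrightarrow> v \<in> tangent_space M x \<and> D \<nu> x v = (- \<kappa>) *\<^sub>R D f x v"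
proof
  assume "v \<in> tangent_space M x \<and> D \<nu> x v = (- \<kappa>) *\<^sub>R D f x v"
  then show "v \<in> principal_space M F N x \<kappa>"
    using f_isometric[OF x] by (simp add: principal_space_iff_form[OF x])
next
  assume "v \<in> principal_space M F N x \<kappa>"
  then have v: "v \<in> tangent_space M x"
    and form: "\<And>w. w \<in> tangent_space M x \<Longrightarrow> - (D \<nu> x v \<bullet> D f x w) = \<kappa> * (v \<bullet> w)"
    by (auto simp: principal_space_iff_form[OF x])
  define u where "u = D \<nu> x v + \<kappa> *\<^sub>R D f x v"
  have "N x \<bullet> u = 0"
    using normal_f[OF M_\<Omega>[OF x], of v] normal_\<nu>[OF M_\<Omega>[OF x], of v]
    by (simp add: u_def \<nu>_M[OF x] inner_add_right)
  then obtain w where w: "w \<in> tangent_space M x" "u = D f x w"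
    using D_f_onto[OF x] by blast
  have "u \<bullet> D f x w = 0"
    using form[OF w(1)] f_isometric[OF x v w(1)] by (simp add: u_def inner_add_left)
  then have "u = 0" using w(2) by simp
  then show "v \<in> tangent_space M x \<and> D \<nu> x v = (- \<kappa>) *\<^sub>R D f x v"
    using v by (simp add: u_def add_eq_0_iff2)
qed

lemma round_D: "x \<in> M \<Longrightarrow> a \<in> round x \<Longrightarrow> D f x a = - r0 *\<^sub>R D \<nu> x a"
  using r0_pos by (simp add: round_def principal_space_iff)

lemma flat_D: "x \<in> M \<Longrightarrow> b \<in> flat x \<Longrightarrow> D \<nu> x b = 0"
  by (simp add: flat_def principal_space_iff)

lemma round_tangent: "x \<in> M \<Longrightarrow> a \<in> round x \<Longrightarrow> a \<in> tangent_space M x"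
  and flat_tangent: "x \<in> M \<Longrightarrow> a \<in> flat x \<Longrightarrow> a \<in> tangent_space M x"
  by (simp_all add: round_def flat_def principal_space_iff)

lemma round_orthogonal_flat:
  assumes x: "x \<in> M" and a: "a \<in> round x" and b: "b \<in> flat x"
  shows "a \<bullet> b = 0"
proof -
  have "D \<nu> x a \<bullet> D f x b = 0"
    using shape_symmetric[OF M_\<Omega>[OF x], of a b] flat_D[OF x b] by simp
  then have "D f x a \<bullet> D f x b = 0" by (simp add: round_D[OF x a])
  then show ?thesis using f_isometric[OF x round_tangent[OF x a] flat_tangent[OF x b]] by simp
qed

text \<open>The focal map. It collapses the round directions and has the same derivative as \<open>f\<close> in the flat
  ones; its image will turn out to be the axis of the cylinder.\<close>

definition g where "g p = f p + r0 *\<^sub>R \<nu> p"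

lemma g_smooth: "Ck_on k \<Omega> g"
  unfolding g_def[abs_def]
  by (intro Ck_on_add Ck_on_scaleR Ck_on_const open_\<Omega> f_smooth \<nu>_smooth)

lemma g_der: "p \<in> \<Omega> \<Longrightarrow> (g has_derivative D g p) (at p)"
  using Ck_on_has_derivative[OF g_smooth open_\<Omega>] .

lemma g_lin: "p \<in> \<Omega> \<Longrightarrow> linear (D g p)"
  using g_der has_derivative_linear by blast

lemma D_g:
  assumes "p \<in> \<Omega>"
  shows "D g p X = D f p X + r0 *\<^sub>R D \<nu> p X"
proof -
  have "(g has_derivative (\<lambda>X. D f p X + r0 *\<^sub>R D \<nu> p X)) (at p)"
    unfolding g_def[abs_def]
    by (intro has_derivative_add has_derivative_scaleR_right f_der \<nu>_der assms)
  then show ?thesis using D_eqI by metis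
qed

lemma D_g_round: "x \<in> M \<Longrightarrow> a \<in> round x \<Longrightarrow> D g x a = 0"
  by (simp add: D_g M_\<Omega> round_D)

lemma D_g_flat: "x \<in> M \<Longrightarrow> b \<in> flat x \<Longrightarrow> D g x b = D f x b"
  by (simp add: D_g M_\<Omega> flat_D)

lemma g_retract: "p \<in> \<Omega> \<Longrightarrow> D g p X = D g (\<rho> p) (D \<rho> p X)"
  using f_retract[of p X] \<nu>_retract[of p X] by (simp add: D_g M_\<Omega> \<rho>_in)

lemma decompE:
  assumes x: "x \<in> M"
  obtains a b where "a \<in> round x" "b \<in> flat x" "D \<rho> x X = a + b"
    "D f x X = D f x a + D f x b" "D \<nu> x X = D \<nu> x a" "D g x X = D f x b"
proof -
  have "D \<rho> x X \<in> tangent_space M x" using D_\<rho>_tangent[OF M_\<Omega>[OF x]] \<rho>_id[OF x] by metis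
  then obtain a b where ab: "a \<in> round x" "b \<in> flat x" "D \<rho> x X = a + b"
    using tangent_decomp[OF x] by blast
  have "D f x X = D f x (a + b)" "D \<nu> x X = D \<nu> x (a + b)" "D g x X = D g x (a + b)"
    using f_retract[OF M_\<Omega>[OF x]] \<nu>_retract[OF M_\<Omega>[OF x]] g_retract[OF M_\<Omega>[OF x]] ab \<rho>_id[OF x] by metis+
  then show thesis
    using that[OF ab] ab f_lin[OF M_\<Omega>[OF x]] \<nu>_lin[OF M_\<Omega>[OF x]] g_lin[OF M_\<Omega>[OF x]]
    by (simp add: linear_add D_g_round D_g_flat x flat_D)
qed

text \<open>The range of \<open>dg\<close> is the image of the flat directions, the range of \<open>d\<nu>\<close> that of the round ones.\<close>

lemma D_g_D_\<nu>_M: "x \<in> M \<Longrightarrow> D g x X \<bullet> D \<nu> x Y = 0"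
proof -
  assume x: "x \<in> M"
  obtain a b where 1: "b \<in> flat x" "D g x X = D f x b" by (rule decompE[OF x])
  obtain a' b' where 2: "a' \<in> round x" "D \<nu> x Y = D \<nu> x a'" by (rule decompE[OF x])
  have "D f x b \<bullet> D f x a' = 0"
    using f_isometric[OF x flat_tangent[OF x 1(1)] round_tangent[OF x 2(1)]]
      round_orthogonal_flat[OF x 2(1) 1(1)] by (simp add: inner_commute)
  then show ?thesis using 1 2 r0_pos by (simp add: round_D[OF x 2(1)])
qed

lemma D_g_D_\<nu>: "p \<in> \<Omega> \<Longrightarrow> D g p X \<bullet> D \<nu> p Y = 0"
  using g_retract \<nu>_retract D_g_D_\<nu>_M \<rho>_in by metis

lemma D_g_\<nu>: "p \<in> \<Omega> \<Longrightarrow> D g p X \<bullet> \<nu> p = 0"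
  using normal_f[of p X] normal_\<nu>[of p X] by (simp add: D_g inner_commute[of _ "\<nu> p"] inner_add_right)

lemma D2_der: "Ck_on 2 \<Omega> h \<Longrightarrow> p \<in> \<Omega> \<Longrightarrow> ((\<lambda>q. D h q X) has_derivative D (\<lambda>q. D h q X) p) (at p)"
  using Ck_on_has_derivative[OF _ open_\<Omega>, of 0 "\<lambda>q. D h q X" p] by (simp add: numeral_2_eq_2)

lemma D2_g_\<nu>:
  assumes p: "p \<in> \<Omega>"
  shows "D (\<lambda>q. D g q X) p Z \<bullet> \<nu> p = 0"
proof -
  have "D g p X \<bullet> D \<nu> p Z + D (\<lambda>q. D g q X) p Z \<bullet> \<nu> p = 0"
    by (rule D_inner_const[OF p D_g_\<nu> D2_der[OF g_smooth p] \<nu>_der[OF p]])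
  then show ?thesis by (simp add: D_g_D_\<nu> p)
qed

lemma D2_g_D_\<nu>:
  assumes p: "p \<in> \<Omega>"
  shows "D (\<lambda>q. D g q X) p Z \<bullet> D \<nu> p Y = - (D g p X \<bullet> D (\<lambda>q. D \<nu> q Y) p Z)"
proof -
  have "D g p X \<bullet> D (\<lambda>q. D \<nu> q Y) p Z + D (\<lambda>q. D g q X) p Z \<bullet> D \<nu> p Y = 0"
    by (rule D_inner_const[OF p D_g_D_\<nu> D2_der[OF g_smooth p] D2_der[OF \<nu>_smooth p]])
  then show ?thesis by simp
qed

text \<open>The trilinear form \<open>T Z X Y\<close>, the inner product of the second derivative of \<open>g\<close> along \<open>Z, X\<close> with
  \<open>d\<nu> Y\<close>, is symmetric in \<open>Z, X\<close>. Differentiating \<open>dg X \<bullet> d\<nu> Y = 0\<close> turns it into the inner product of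
  \<open>- dg X\<close> with a second derivative of \<open>\<nu>\<close>, so it is symmetric in \<open>Z, Y\<close> as well. Only the round part of
  \<open>Y\<close> contributes, and when this part is moved into the middle slot it is annihilated by \<open>dg\<close>. This
  plays the role of the Codazzi equation.\<close>

lemma D2_g_D_\<nu>_zero:
  assumes x: "x \<in> M"
  shows "D (\<lambda>q. D g q X) x Z \<bullet> D \<nu> x Y = 0"
proof -
  note p = M_\<Omega>[OF x]
  define T where "T Z X Y = D (\<lambda>q. D g q X) x Z \<bullet> D \<nu> x Y" for Z X Y
  have T1: "T Z X Y = T X Z Y" for X Y Z
    using second_derivative_symmetric[OF g_smooth open_\<Omega> p] by (simp add: T_def)
  have T2: "T Z X Y = - (D g x X \<bullet> D (\<lambda>q. D \<nu> q Y) x Z)" for X Y Z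
    using D2_g_D_\<nu>[OF p] by (simp add: T_def)
  have T3: "T Z X Y = T Y X Z" for X Y Z
    using second_derivative_symmetric[OF \<nu>_smooth open_\<Omega> p, of Y Z] by (simp add: T2)
  obtain a b where ab: "a \<in> round x" "D \<nu> x Y = D \<nu> x a" by (rule decompE[OF x])
  have "T Z X Y = T Z X a" by (simp add: T_def ab)
  also have "\<dots> = T Z a X" using T1 T3 by metis
  also have "\<dots> = 0" by (simp add: T2 D_g_round x ab)
  finally show ?thesis by (simp add: T_def)
qed

lemma flat_rangeE:
  assumes x: "x \<in> M" and "u \<bullet> \<nu> x = 0" and orth: "\<And>Y. u \<bullet> D \<nu> x Y = 0"
  obtains b where "b \<in> flat x" "u = D g x b" "norm b = norm u"
proof -
  have "N x \<bullet> u = 0" using assms by (simp add: \<nu>_M inner_commute)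
  then obtain v where v: "v \<in> tangent_space M x" "u = D f x v"
    using D_f_onto[OF x] by blast
  obtain a b where ab: "a \<in> round x" "b \<in> flat x" "v = a + b"
    using v tangent_decomp[OF x] by blast
  have u: "u = D f x a + D f x b" using v ab f_lin[OF M_\<Omega>[OF x]] by (simp add: linear_add)
  have "u \<bullet> D f x a = 0" using orth[of a] by (simp add: round_D[OF x ab(1)])
  moreover have "D f x b \<bullet> D f x a = 0"
    using f_isometric[OF x flat_tangent[OF x ab(2)] round_tangent[OF x ab(1)]]
      round_orthogonal_flat[OF x ab(1,2)] by (simp add: inner_commute)
  ultimately have "D f x a = 0" by (simp add: u inner_add_left)
  then have ub: "u = D f x b" using u by simp
  moreover have "norm b = norm u"
    using f_isometric[OF x flat_tangent[OF x ab(2)] flat_tangent[OF x ab(2)]] ub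
    by (simp add: norm_eq_sqrt_inner)
  ultimately show thesis using that[OF ab(2)] D_g_flat[OF x ab(2)] by simp
qed

text \<open>So the second derivatives of \<open>g\<close> stay in the range of \<open>dg\<close>, and because \<open>dg\<close> is isometric on flat
  directions they have preimages of the same size. The latter gives the bound needed to conclude that
  this range does not change from point to point.\<close>

lemma D2_g_rangeE:
  assumes x: "x \<in> M"
  obtains b where "D (\<lambda>q. D g q X) x Z = D g x b" "norm b = norm (D (\<lambda>q. D g q X) x Z)"
  using flat_rangeE[OF x D2_g_\<nu>[OF M_\<Omega>[OF x]] D2_g_D_\<nu>_zero[OF x]] by metis

end

section \<open>Cylinders\<close>

lemma dim_orthogonal_comp:
  fixes V :: "'a::euclidean_space set"
  assumes "subspace V"
  shows "dim (V\<^sup>\<bottom>) + dim V = DIM('a)"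
  using dim_subspace_orthogonal_to_vectors[OF assms subspace_UNIV]
  by (simp add: orthogonal_comp_def)

text \<open>The cylinder is a continuous image of \<open>(V\<^sup>\<bottom> - {0}) \<times> V\<close>, and a punctured space of dimension at least 2 is
  connected.\<close>

lemma connected_cylinder:
  fixes V :: "'a::euclidean_space set"
  assumes V: "subspace V" "dim V + 2 \<le> DIM('a)" and r: "r > 0"
  shows "connected (cylinder c V r)"
proof -
  define h where "h = (\<lambda>(u, v). c + (r / norm u) *\<^sub>R u + v :: 'a)"
  have W: "subspace (V\<^sup>\<bottom>)" by (rule subspace_orthogonal_comp)
  have "dim (V\<^sup>\<bottom>) \<ge> 2" using dim_orthogonal_comp[OF V(1)] V(2) by simp
  then have "aff_dim (V\<^sup>\<bottom>) \<noteq> 1" using aff_dim_subspace[OF W] by simp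
  then have "connected (V\<^sup>\<bottom> - {0})"
    using connected_punctured_convex subspace_imp_convex[OF W] by blast
  then have "connected ((V\<^sup>\<bottom> - {0}) \<times> V)"
    using subspace_imp_convex[OF V(1)] convex_connected by (intro connected_Times) auto
  moreover have "continuous_on ((V\<^sup>\<bottom> - {0}) \<times> V) h"
    unfolding h_def case_prod_beta by (intro continuous_intros) auto
  moreover have "h ` ((V\<^sup>\<bottom> - {0}) \<times> V) = cylinder c V r"
  proof (intro equalityI subsetI)
    fix y assume "y \<in> h ` ((V\<^sup>\<bottom> - {0}) \<times> V)"
    then obtain u v where uv: "u \<in> V\<^sup>\<bottom>" "u \<noteq> 0" "v \<in> V" "y = c + (r / norm u) *\<^sub>R u + v"
      by (auto simp: h_def)
    then show "y \<in> cylinder c V r"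
      unfolding cylinder_def using r subspace_scale[OF W uv(1), of "r / norm u"]
      by (intro CollectI exI[of _ "(r / norm u) *\<^sub>R u"] exI[of _ v]) auto
  next
    fix y assume "y \<in> cylinder c V r"
    then obtain u v where uv: "u \<in> V\<^sup>\<bottom>" "norm u = r" "v \<in> V" "y = c + u + v"
      by (auto simp: cylinder_def)
    then have "y = h (u, v)" using r by (simp add: h_def)
    moreover have "u \<noteq> 0" using uv r by auto
    ultimately show "y \<in> h ` ((V\<^sup>\<bottom> - {0}) \<times> V)" using uv by blast
  qed
  ultimately show ?thesis using connected_continuous_image by metis
qed

lemma cylinder_hausdorff_tendsto:
  fixes V :: "'a::euclidean_space set"
  assumes V: "subspace V" "dim V < DIM('a)" and r: "(r \<longlongrightarrow> 0) A" "\<And>t. r t > 0"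
  shows "hausdorff_tendsto (\<lambda>t. cylinder c V (r t)) ((\<lambda>v. c + v) ` V) A"
  unfolding hausdorff_tendsto_def
proof (intro allI impI)
  fix \<epsilon> :: real assume "\<epsilon> > 0"
  have "\<not> V\<^sup>\<bottom> \<subseteq> {0}"
  proof
    assume "V\<^sup>\<bottom> \<subseteq> {0}"
    then have "dim (V\<^sup>\<bottom>) = 0" by simp
    then show False using dim_orthogonal_comp[OF V(1)] V(2) by linarith
  qed
  then obtain e where e: "e \<in> V\<^sup>\<bottom>" "e \<noteq> 0" by blast
  have "\<forall>\<^sub>F t in A. dist (r t) 0 < \<epsilon>" using tendstoD[OF r(1) \<open>\<epsilon> > 0\<close>] .
  then show "\<forall>\<^sub>F t in A. (\<forall>a\<in>cylinder c V (r t). \<exists>l\<in>(\<lambda>v. c + v) ` V. dist a l < \<epsilon>) \<and>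
      (\<forall>l\<in>(\<lambda>v. c + v) ` V. \<exists>a\<in>cylinder c V (r t). dist a l < \<epsilon>)"
  proof eventually_elim
    case (elim t)
    then have t: "r t < \<epsilon>" using r(2)[of t] by simp
    show ?case
    proof (intro conjI ballI)
      fix a assume "a \<in> cylinder c V (r t)"
      then obtain u v where "norm u = r t" "v \<in> V" "a = c + u + v" by (auto simp: cylinder_def)
      then show "\<exists>l\<in>(\<lambda>v. c + v) ` V. dist a l < \<epsilon>"
        using t by (intro bexI[of _ "c + v"]) (auto simp: dist_norm)
    next
      fix l assume "l \<in> (\<lambda>v. c + v) ` V"
      then obtain v where v: "v \<in> V" "l = c + v" by blast
      define u where "u = (r t / norm e) *\<^sub>R e"
      have u: "u \<in> V\<^sup>\<bottom>" "norm u = r t"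
        using e r(2)[of t] subspace_scale[OF subspace_orthogonal_comp e(1)] by (auto simp: u_def)
      then have "c + u + v \<in> cylinder c V (r t)" using v unfolding cylinder_def by blast
      moreover have "dist (c + u + v) l < \<epsilon>" using u t v by (simp add: dist_norm)
      ultimately show "\<exists>a\<in>cylinder c V (r t). dist a l < \<epsilon>" by blast
    qed
  qed
qed

lemma cylinder_0: "cylinder c {0} r = sphere c r"
  unfolding cylinder_def by (auto simp: dist_norm norm_minus_commute intro: exI[of _ "x - c" for x])

section \<open>The axis\<close>

text \<open>A Gronwall argument: on a ball of radius \<open>\<epsilon>\<close> the mean value inequality bounds the maximum of the sum
  of the \<open>\<bar>\<phi> i\<bar>\<close> by \<open>K \<epsilon>\<close> times itself, and \<open>K \<epsilon> < 1\<close> for small \<open>\<epsilon>\<close>.\<close>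

lemma vanishes_near:
  fixes \<phi> :: "'i \<Rightarrow> 'e::euclidean_space \<Rightarrow> real"
  assumes fin: "finite I" and \<delta>: "\<delta> > 0"
    and der: "\<And>i p. i \<in> I \<Longrightarrow> p \<in> cball p0 \<delta> \<Longrightarrow> (\<phi> i has_derivative \<phi>' i p) (at p)"
    and bound: "\<And>i p Z. i \<in> I \<Longrightarrow> p \<in> cball p0 \<delta> \<Longrightarrow> \<bar>\<phi>' i p Z\<bar> \<le> C * norm Z * (\<Sum>j\<in>I. \<bar>\<phi> j p\<bar>)"
    and C: "C \<ge> 0" and zero: "\<And>i. i \<in> I \<Longrightarrow> \<phi> i p0 = 0"
  shows "\<exists>\<epsilon>>0. \<forall>p\<in>cball p0 \<epsilon>. \<forall>i\<in>I. \<phi> i p = 0"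
proof -
  define K where "K = real (card I) * C + 1"
  have K: "K > 0" using C by (simp add: K_def add_nonneg_pos)
  define \<epsilon> where "\<epsilon> = min \<delta> (1 / (2 * K))"
  have \<epsilon>: "\<epsilon> > 0" "\<epsilon> \<le> \<delta>" "K * \<epsilon> \<le> 1 / 2"
    using \<delta> K by (auto simp: \<epsilon>_def min_def field_simps)
  have sub: "cball p0 \<epsilon> \<subseteq> cball p0 \<delta>" using \<epsilon> by (simp add: subset_cball)
  define \<Phi> where "\<Phi> p = (\<Sum>j\<in>I. \<bar>\<phi> j p\<bar>)" for p
  have "continuous_on (cball p0 \<epsilon>) (\<phi> i)" if "i \<in> I" for i
    using der[OF that] sub has_derivative_continuous
    by (intro continuous_at_imp_continuous_on) blast
  then have "continuous_on (cball p0 \<epsilon>) \<Phi>"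
    unfolding \<Phi>_def[abs_def] by (intro continuous_intros) auto
  then obtain p1 where p1: "p1 \<in> cball p0 \<epsilon>" "\<And>p. p \<in> cball p0 \<epsilon> \<Longrightarrow> \<Phi> p \<le> \<Phi> p1"
    using continuous_attains_sup[OF compact_cball, of p0 \<epsilon> \<Phi>] \<epsilon>(1)
    by (metis centre_in_cball empty_iff less_imp_le)
  have nonneg: "\<Phi> p \<ge> 0" for p by (simp add: \<Phi>_def sum_nonneg)
  have "\<bar>\<phi> i p1\<bar> \<le> C * \<Phi> p1 * \<epsilon>" if i: "i \<in> I" for i
  proof -
    have "norm (\<phi> i p1 - \<phi> i p0) \<le> C * \<Phi> p1 * norm (p1 - p0)"
    proof (rule differentiable_bound[OF convex_cball])
      fix p assume p: "p \<in> cball p0 \<epsilon>"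
      show "(\<phi> i has_derivative \<phi>' i p) (at p within cball p0 \<epsilon>)"
        by (rule has_derivative_at_withinI[OF der[OF i subsetD[OF sub p]]])
      show "onorm (\<phi>' i p) \<le> C * \<Phi> p1"
      proof (rule onorm_bound)
        show "0 \<le> C * \<Phi> p1" using C nonneg by simp
        fix Z
        have "norm (\<phi>' i p Z) \<le> C * norm Z * \<Phi> p" using bound[OF i subsetD[OF sub p], of Z] by (simp add: \<Phi>_def)
        also have "\<dots> \<le> C * norm Z * \<Phi> p1" using p1(2)[OF p] C by (intro mult_left_mono) auto
        finally show "norm (\<phi>' i p Z) \<le> C * \<Phi> p1 * norm Z" by (simp add: mult_ac)
      qed
    qed (use p1 \<epsilon> in auto)
    also have "\<dots> \<le> C * \<Phi> p1 * \<epsilon>"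
      using p1(1) C nonneg by (intro mult_left_mono) (auto simp: dist_norm norm_minus_commute)
    finally show ?thesis using zero[OF i] by simp
  qed
  then have "(\<Sum>j\<in>I. \<bar>\<phi> j p1\<bar>) \<le> (\<Sum>j\<in>I. C * \<Phi> p1 * \<epsilon>)" by (rule sum_mono)
  then have "\<Phi> p1 \<le> (\<Sum>j\<in>I. C * \<Phi> p1 * \<epsilon>)" by (simp only: \<Phi>_def[symmetric])
  also have "\<dots> = (K - 1) * \<epsilon> * \<Phi> p1" by (simp add: K_def mult_ac)
  also have "\<dots> \<le> 1 / 2 * \<Phi> p1"
    using \<epsilon> nonneg by (intro mult_right_mono) (auto simp: algebra_simps)
  finally have "\<Phi> p1 \<le> 0" by simp
  then have "\<Phi> p = 0" if "p \<in> cball p0 \<epsilon>" for p using p1(2)[OF that] nonneg[of p] by simp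
  then have "\<forall>p\<in>cball p0 \<epsilon>. \<forall>i\<in>I. \<phi> i p = 0"
    using fin by (simp add: \<Phi>_def sum_nonneg_eq_0_iff)
  then show ?thesis using \<epsilon>(1) by blast
qed

context cylindrical_immersion
begin

text \<open>The axis of the cylinder is \<open>c + V\<close>, read off from the focal map at one base point.\<close>

definition x0 where "x0 = (SOME x. x \<in> M)"
definition V where "V = range (D g x0)"
definition c where "c = g x0"

lemma x0: "x0 \<in> M" using M_nonempty by (simp add: x0_def some_in_eq)

lemma range_D_g:
  assumes x: "x \<in> M"
  shows "subspace (range (D g x))" "dim (range (D g x)) = d"
proof -
  have lin: "linear (D f x)" "linear (D g x)" using f_lin g_lin M_\<Omega>[OF x] by auto
  show "subspace (range (D g x))" by (rule linear_subspace_image[OF lin(2) subspace_UNIV])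
  have "range (D g x) = D f x ` flat x"
  proof (intro equalityI subsetI)
    fix y assume "y \<in> range (D g x)"
    then obtain X where X: "y = D g x X" by blast
    obtain b where b: "b \<in> flat x" "D g x X = D f x b" by (rule decompE[OF x, of X])
    show "y \<in> D f x ` flat x" unfolding X b(2) using b(1) by (rule imageI)
  next
    fix y assume "y \<in> D f x ` flat x"
    then obtain b where "b \<in> flat x" "y = D f x b" by blast
    then have "y = D g x b" using D_g_flat[OF x] by simp
    then show "y \<in> range (D g x)" by blast
  qed
  moreover have "inj_on (D f x) (span (flat x))"
  proof -
    have B: "subspace (flat x)" using subspace_principal[OF x] by (simp add: flat_def)
    have "v = w" if "v \<in> flat x" "w \<in> flat x" "D f x v = D f x w" for v w
    proof -
      have "v - w \<in> tangent_space M x"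
        using that by (intro flat_tangent[OF x] subspace_diff[OF B])
      then have "(v - w) \<bullet> (v - w) = 0"
        using f_isometric[OF x, of "v - w" "v - w"] that(3) lin(1) by (simp add: linear_diff)
      then show ?thesis by simp
    qed
    then have "inj_on (D f x) (flat x)" by (intro inj_onI)
    then show ?thesis by (simp add: span_eq_iff[THEN iffD2, OF B])
  qed
  ultimately show "dim (range (D g x)) = d"
    using dim_image_eq[OF lin(1), of "flat x"] dim_flat_space[OF x] by simp
qed

lemma subspace_V: "subspace V" and dim_V: "dim V = d"
  using range_D_g[OF x0] by (simp_all add: V_def)

text \<open>Fix \<open>u\<close> orthogonal to \<open>V\<close>. The functions \<open>p \<mapsto> dg i \<bullet> u\<close>, evaluated at \<open>\<rho> p\<close> for the basis vectors \<open>i\<close>,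
  vanish at the base point, and their derivatives are again combinations of them with locally bounded
  coefficients. Hence their common zero set is open as well as closed, and it is all of \<open>\<Omega>\<close>.\<close>

lemma D_g_in_V:
  assumes p: "p \<in> \<Omega>"
  shows "D g p X \<in> V"
proof -
  define G where "G i q = D g (\<rho> q) i" for i q
  have \<rho>\<Omega>: "\<rho> ` \<Omega> \<subseteq> \<Omega>" using \<rho>_in M_\<Omega> by auto
  have hC: "Ck_on (Suc 0) \<Omega> (\<lambda>q. D g q i)" for i using g_smooth[of "Suc (Suc 0)"] by simp
  have GC: "Ck_on (Suc 0) \<Omega> (G i)" for i
    unfolding G_def[abs_def] by (rule Ck_on_compose[OF open_\<Omega> open_\<Omega> \<rho>\<Omega> smooth_\<rho> hC])
  have G_der: "(G i has_derivative D (G i) q) (at q)" if "q \<in> \<Omega>" for i q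
    using Ck_on_has_derivative[OF GC open_\<Omega> that] .
  have D_G: "D (G i) q Z = D (\<lambda>q. D g q i) (\<rho> q) (D \<rho> q Z)" if q: "q \<in> \<Omega>" for i q Z
  proof -
    have "(G i has_derivative (\<lambda>Z. D (\<lambda>q. D g q i) (\<rho> q) (D \<rho> q Z))) (at q)"
      unfolding G_def[abs_def]
      by (rule has_derivative_compose[OF D_\<rho>[OF q] Ck_on_has_derivative[OF hC open_\<Omega>]])
        (use q \<rho>\<Omega> in auto)
    then show ?thesis using D_eqI by metis
  qed
  have "D g q X \<bullet> u = 0" if u: "u \<in> V\<^sup>\<bottom>" and q: "q \<in> \<Omega>" for u q X
  proof -
    define \<phi> where "\<phi> i p = G i p \<bullet> u" for i p
    define S where "S p = (\<forall>i\<in>Basis. \<phi> i p = 0)" for p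
    have lin_sum: "D g (\<rho> p) b \<bullet> u = (\<Sum>j\<in>Basis. (b \<bullet> j) * \<phi> j p)" if "p \<in> \<Omega>" for p b
    proof -
      have "linear (D g (\<rho> p))" using that \<rho>\<Omega> g_lin by auto
      then have "D g (\<rho> p) (\<Sum>j\<in>Basis. (b \<bullet> j) *\<^sub>R j) = (\<Sum>j\<in>Basis. (b \<bullet> j) *\<^sub>R D g (\<rho> p) j)"
        by (simp add: linear_sum linear_cmul)
      then show ?thesis by (simp add: euclidean_representation inner_sum_left \<phi>_def G_def)
    qed
    have \<phi>_der: "(\<phi> i has_derivative (\<lambda>Z. D (G i) p Z \<bullet> u)) (at p)" if "p \<in> \<Omega>" for i p
      unfolding \<phi>_def[abs_def] by (intro has_derivative_inner_left G_der that)
    have \<phi>_bound: "\<bar>D (G i) p Z \<bullet> u\<bar> \<le> norm (D (G i) p Z) * (\<Sum>j\<in>Basis. \<bar>\<phi> j p\<bar>)"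
      if p\<Omega>: "p \<in> \<Omega>" for i p Z
    proof -
      obtain b where b: "D (G i) p Z = D g (\<rho> p) b" "norm b = norm (D (G i) p Z)"
        using D2_g_rangeE[OF \<rho>_in[OF p\<Omega>], of i "D \<rho> p Z"] D_G[OF p\<Omega>, of i Z] by metis
      have "\<bar>D (G i) p Z \<bullet> u\<bar> \<le> (\<Sum>j\<in>Basis. \<bar>(b \<bullet> j) * \<phi> j p\<bar>)"
        unfolding b(1) lin_sum[OF p\<Omega>] by (rule sum_abs)
      also have "\<dots> \<le> (\<Sum>j\<in>Basis. norm b * \<bar>\<phi> j p\<bar>)"
        by (intro sum_mono) (simp add: abs_mult Basis_le_norm mult_right_mono)
      finally show ?thesis by (simp add: b(2) sum_distrib_left)
    qed
    have near: "\<forall>\<^sub>F p' in at p within \<Omega>. S p = S p'" if p: "p \<in> \<Omega>" for p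
    proof (cases "S p")
      case True
      obtain \<delta> where \<delta>: "\<delta> > 0" "cball p \<delta> \<subseteq> \<Omega>"
        using open_contains_cball_eq[OF open_\<Omega>] p by blast
      define B where "B p' = (\<Sum>i\<in>Basis. \<Sum>j\<in>Basis. norm (D (G i) p' j))" for p'
      have "continuous_on (cball p \<delta>) (\<lambda>p'. D (G i) p' j)" for i j
      proof -
        have "continuous_on \<Omega> (\<lambda>p'. D (G i) p' j)" using GC[of i] by simp
        then show ?thesis using \<delta>(2) by (rule continuous_on_subset)
      qed
      then have "continuous_on (cball p \<delta>) B"
        unfolding B_def[abs_def] by (intro continuous_intros) auto
      then have "\<exists>p1\<in>cball p \<delta>. \<forall>p'\<in>cball p \<delta>. B p' \<le> B p1"
        using \<delta>(1) by (intro continuous_attains_sup compact_cball) auto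
      then obtain p1 where p1: "\<And>p'. p' \<in> cball p \<delta> \<Longrightarrow> B p' \<le> B p1" by blast
      have G_bound: "norm (D (G i) p' Z) \<le> B p1 * norm Z"
        if p': "p' \<in> cball p \<delta>" and i: "i \<in> Basis" for i p' Z
      proof -
        have "linear (D (G i) p')" using G_der p' \<delta>(2) has_derivative_linear by blast
        then have "D (G i) p' (\<Sum>j\<in>Basis. (Z \<bullet> j) *\<^sub>R j) = (\<Sum>j\<in>Basis. (Z \<bullet> j) *\<^sub>R D (G i) p' j)"
          by (simp add: linear_sum linear_cmul)
        then have "D (G i) p' Z = (\<Sum>j\<in>Basis. (Z \<bullet> j) *\<^sub>R D (G i) p' j)"
          by (simp add: euclidean_representation)
        then have "norm (D (G i) p' Z) \<le> (\<Sum>j\<in>Basis. norm ((Z \<bullet> j) *\<^sub>R D (G i) p' j))"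
          by (simp only: norm_sum)
        also have "\<dots> \<le> (\<Sum>j\<in>Basis. norm Z * norm (D (G i) p' j))"
          by (intro sum_mono) (simp add: Basis_le_norm mult_right_mono)
        also have "\<dots> = norm Z * (\<Sum>j\<in>Basis. norm (D (G i) p' j))" by (simp add: sum_distrib_left)
        also have "\<dots> \<le> norm Z * B p'"
          unfolding B_def
          by (intro mult_left_mono member_le_sum[where f="\<lambda>i. \<Sum>j\<in>Basis. norm (D (G i) p' j)", OF i])
            (auto intro: sum_nonneg)
        also have "\<dots> \<le> norm Z * B p1" using p1[OF p'] by (intro mult_left_mono) auto
        finally show ?thesis by (simp add: mult.commute)
      qed
      have "\<exists>\<epsilon>>0. \<forall>p'\<in>cball p \<epsilon>. \<forall>i\<in>Basis. \<phi> i p' = 0"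
      proof (rule vanishes_near[OF finite_Basis \<delta>(1)])
        fix i :: 'e and p' Z assume i: "i \<in> Basis" and p': "p' \<in> cball p \<delta>"
        then have p'\<Omega>: "p' \<in> \<Omega>" using \<delta>(2) by blast
        show "(\<phi> i has_derivative (\<lambda>Z. D (G i) p' Z \<bullet> u)) (at p')" by (rule \<phi>_der[OF p'\<Omega>])
        show "\<bar>D (G i) p' Z \<bullet> u\<bar> \<le> B p1 * norm Z * (\<Sum>j\<in>Basis. \<bar>\<phi> j p'\<bar>)"
          by (rule order_trans[OF \<phi>_bound[OF p'\<Omega>] mult_right_mono[OF G_bound[OF p' i]]]) (simp add: sum_nonneg)
      next
        show "B p1 \<ge> 0" by (simp add: B_def sum_nonneg)
      qed (use True S_def in auto)
      then obtain \<epsilon> where "\<epsilon> > 0" "\<And>p'. p' \<in> cball p \<epsilon> \<Longrightarrow> S p'" unfolding S_def by blast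
      then show ?thesis using True by (auto simp: eventually_at dist_commute intro!: exI[of _ \<epsilon>])
    next
      case False
      then obtain i where i: "i \<in> Basis" "\<phi> i p \<noteq> 0" by (auto simp: S_def)
      have "isCont (\<phi> i) p" using \<phi>_der[OF p] has_derivative_continuous by blast
      then have "\<forall>\<^sub>F p' in at p. \<phi> i p' \<noteq> 0"
        using i(2) by (intro tendsto_imp_eventually_ne) (auto simp: isCont_def)
      then have "\<forall>\<^sub>F p' in at p within \<Omega>. \<phi> i p' \<noteq> 0"
        by (rule filter_leD[OF at_le[OF subset_UNIV]])
      then show ?thesis by (rule eventually_mono) (use False i in \<open>auto simp: S_def\<close>)
    qed
    have "S x0" unfolding S_def \<phi>_def G_def
      using u x0 by (auto simp: \<rho>_id V_def orthogonal_comp_def orthogonal_def)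
    then have "S q"
      using connected_local_const[OF connected_\<Omega> M_\<Omega>[OF x0] q, of S] near by simp
    then show ?thesis
      unfolding g_retract[OF q] lin_sum[OF q] by (simp add: S_def)
  qed
  then have "D g p X \<in> V\<^sup>\<bottom>\<^sup>\<bottom>"
    using p by (auto simp: orthogonal_comp_def[of "V\<^sup>\<bottom>"] orthogonal_def inner_commute)
  then show ?thesis by (simp add: orthogonal_comp_self subspace_V)
qed

lemma range_D_g_eq: "x \<in> M \<Longrightarrow> range (D g x) = V"
  using subspace_dim_equal[OF range_D_g(1) subspace_V, of x] range_D_g(2)[of x] dim_V
    D_g_in_V[OF M_\<Omega>] by auto

lemma N_perp_V:
  assumes x: "x \<in> M"
  shows "N x \<in> V\<^sup>\<bottom>"
proof -
  have "D g x X \<bullet> N x = 0" for X using D_g_\<nu>[OF M_\<Omega>[OF x]] by (simp add: \<nu>_M x)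
  then show ?thesis
    by (auto simp: orthogonal_comp_def orthogonal_def simp flip: range_D_g_eq[OF x])
qed

lemma g_in_axis:
  assumes "p \<in> \<Omega>"
  shows "g p - c \<in> V"
proof -
  have "(g p - c) \<bullet> u = 0" if u: "u \<in> V\<^sup>\<bottom>" for u
  proof -
    have "((\<lambda>q. g q \<bullet> u) has_derivative (\<lambda>X. 0)) (at q)" if q: "q \<in> \<Omega>" for q
    proof -
      have "((\<lambda>q. g q \<bullet> u) has_derivative (\<lambda>X. D g q X \<bullet> u)) (at q)"
        by (intro has_derivative_inner_left g_der q)
      moreover have "D g q X \<bullet> u = 0" for X
        using D_g_in_V[OF q] u by (auto simp: orthogonal_comp_def orthogonal_def)
      ultimately show ?thesis by simp
    qed
    then have "g p \<bullet> u = g x0 \<bullet> u"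
      by (rule has_derivative_zero_unique_connected[OF open_\<Omega> connected_\<Omega> _ assms M_\<Omega>[OF x0]])
    then show ?thesis by (simp add: c_def inner_diff_left)
  qed
  then have "g p - c \<in> V\<^sup>\<bottom>\<^sup>\<bottom>"
    by (auto simp: orthogonal_comp_def[of "V\<^sup>\<bottom>"] orthogonal_def inner_commute)
  then show ?thesis by (simp add: orthogonal_comp_self subspace_V)
qed

lemma g_M: "x \<in> M \<Longrightarrow> g x = F x + r0 *\<^sub>R N x"
  by (simp add: g_def f_M \<nu>_M)

lemma norm_N: "x \<in> M \<Longrightarrow> norm (N x) = 1"
  using normal by (simp add: unit_normal_field_def)

end

section \<open>The image is the whole cylinder\<close>

context cylindrical_immersion
begin

text \<open>Minimise \<open>|F p - q| + |p - p0| / 2\<close> over \<open>M\<close>, which is possible because \<open>M\<close> is closed. At a minimum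
  \<open>p\<close> with \<open>F p \<noteq> q\<close> one could move in the tangent direction \<open>v\<close> for which \<open>dF v\<close> is the tangential part \<open>t\<close> of
  \<open>e = q - F p\<close>. As \<open>F\<close> is isometric, the first term decreases at the rate \<open>|t|\<^sup>2 / |e|\<close> and the second one
  increases at most at the rate \<open>|t| / 2\<close>. For \<open>q\<close> at distance at most \<open>r0\<close> the normal part of \<open>e\<close> is at most
  half of \<open>e\<close>, so the decrease wins. This takes the place of lifting paths by completeness.\<close>

lemma cylinder_step:
  assumes p0: "p0 \<in> M" and q: "q \<in> cylinder c V r0" and close: "dist (F p0) q \<le> r0"
  shows "q \<in> F ` M"
proof -
  define \<Phi> where "\<Phi> p = dist (F p) q + dist p p0 / 2" for p
  have "continuous_on \<Omega> f" using f_smooth[of 0] by simp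
  then have contF: "continuous_on M F"
    using continuous_on_subset[OF _ M_sub] f_M continuous_on_cong by metis
  have comp: "compact (M \<inter> cball p0 (2 * r0))"
    by (rule closed_Int_compact[OF closed_M compact_cball])
  have "continuous_on (M \<inter> cball p0 (2 * r0)) \<Phi>"
    unfolding \<Phi>_def[abs_def] using contF
    by (intro continuous_intros) (auto intro: continuous_on_subset)
  moreover have "M \<inter> cball p0 (2 * r0) \<noteq> {}" using p0 r0_pos by auto
  ultimately obtain p where p: "p \<in> M" "p \<in> cball p0 (2 * r0)"
    "\<And>y. y \<in> M \<inter> cball p0 (2 * r0) \<Longrightarrow> \<Phi> p \<le> \<Phi> y"
    using continuous_attains_inf[OF comp] by blast
  have \<Phi>p0: "\<Phi> p \<le> r0" using p(3)[of p0] p0 r0_pos close by (simp add: \<Phi>_def)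
  have min: "\<Phi> p \<le> \<Phi> y" if "y \<in> M" for y
  proof (cases "y \<in> cball p0 (2 * r0)")
    case False
    then have "r0 < dist y p0 / 2" by (simp add: dist_commute)
    also have "\<dots> \<le> \<Phi> y" by (simp add: \<Phi>_def)
    finally have "r0 < \<Phi> y" .
    then show ?thesis using \<Phi>p0 by simp
  qed (use that p in auto)
  have closep: "dist (F p) q \<le> r0" 
  proof -
    have "dist (F p) q \<le> \<Phi> p" by (simp add: \<Phi>_def)
    then show ?thesis using \<Phi>p0 by simp
  qed
  have "F p = q"
  proof (rule ccontr)
    assume "F p \<noteq> q"
    define e where "e = q - F p"
    have e0: "norm e > 0" using \<open>F p \<noteq> q\<close> by (simp add: e_def)
    define t where "t = e - (e \<bullet> N p) *\<^sub>R N p"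
    have NN: "N p \<bullet> N p = 1" using norm_N[OF p(1)] by (simp add: dot_square_norm)
    have "N p \<bullet> t = 0" by (simp add: t_def inner_diff_right NN inner_commute)
    then obtain v where v: "v \<in> tangent_space M p" "t = D f p v"
      using D_f_onto[OF p(1)] by blast
    have norm_v: "norm v = norm t"
      using f_isometric[OF p(1) v(1) v(1)] v(2) by (simp add: norm_eq_sqrt_inner)
    have "e = t + (e \<bullet> N p) *\<^sub>R N p" by (simp add: t_def)
    moreover have "t \<bullet> N p = 0" using \<open>N p \<bullet> t = 0\<close> by (simp add: inner_commute)
    ultimately have te: "t \<bullet> e = (norm t)\<^sup>2"
      by (metis add.right_neutral inner_add_right inner_scaleR_right mult_zero_right power2_norm_eq_inner)
    have "t \<bullet> t = t \<bullet> e" using te by (simp add: power2_norm_eq_inner)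
    also have "\<dots> = e \<bullet> e - (e \<bullet> N p) * (e \<bullet> N p)"
      by (simp add: t_def inner_diff_left inner_commute[of "N p"])
    finally have tt: "(norm t)\<^sup>2 = (norm e)\<^sup>2 - (e \<bullet> N p)\<^sup>2"
      by (simp add: power2_norm_eq_inner) (simp add: power2_eq_square)
    \<comment> \<open>a chord of the cylinder of length at most \<open>r0\<close> makes an angle of at least 60 degrees with the normal\<close>
    have "(e \<bullet> N p)\<^sup>2 \<le> (norm e)\<^sup>2 / 4"
    proof -
      obtain n w where nw: "n \<in> V\<^sup>\<bottom>" "norm n = r0" "w \<in> V" "q = c + n + w"
        using q by (auto simp: cylinder_def)
      define w' where "w' = w - (g p - c)"
      have w': "w' \<in> V" unfolding w'_def
        by (rule subspace_diff[OF subspace_V nw(3) g_in_axis[OF M_\<Omega>[OF p(1)]]])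
      define y where "y = n + r0 *\<^sub>R N p"
      have "y \<in> V\<^sup>\<bottom>" unfolding y_def using nw(1) N_perp_V[OF p(1)]
        by (intro subspace_add subspace_scale subspace_orthogonal_comp)
      then have wy: "w' \<bullet> y = 0" "w' \<bullet> N p = 0" using w' N_perp_V[OF p(1)]
        by (auto simp: orthogonal_comp_def orthogonal_def)
      have e: "e = w' + y" by (simp add: e_def w'_def y_def nw(4) g_M[OF p(1)])
      have nn: "n \<bullet> n = r0 * r0" using nw(2) by (simp add: dot_square_norm power2_eq_square)
      define s where "s = r0 + n \<bullet> N p"
      have eN: "e \<bullet> N p = s"
        by (simp add: e wy inner_add_left y_def NN s_def)
      have "y \<bullet> y = 2 * r0 * s"
        by (simp add: y_def inner_add_left inner_add_right nn NN s_def inner_commute algebra_simps)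
      then have ee: "(norm e)\<^sup>2 = w' \<bullet> w' + 2 * r0 * s"
        using wy by (simp add: e power2_norm_eq_inner inner_add_left inner_add_right inner_commute)
      have "norm e \<le> r0" using closep by (simp add: e_def dist_norm norm_minus_commute)
      then have "(norm e)\<^sup>2 \<le> r0 * r0" using r0_pos by (simp add: power2_eq_square mult_mono)
      then have le: "2 * r0 * s \<le> r0 * r0" using ee by (smt (verit) inner_ge_zero)
      then have s1: "2 * s \<le> r0" using r0_pos by simp
      have "\<bar>n \<bullet> N p\<bar> \<le> r0" using Cauchy_Schwarz_ineq2[of n "N p"] nw(2) norm_N[OF p(1)] by simp
      then have s0: "s \<ge> 0" by (simp add: s_def)
      have "4 * s\<^sup>2 \<le> 2 * r0 * s" using mult_right_mono[OF s1 s0] by (simp add: power2_eq_square)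
      also have "\<dots> \<le> (norm e)\<^sup>2" using ee by simp
      finally show ?thesis by (simp add: eN)
    qed
    then have big: "(norm t)\<^sup>2 \<ge> 3 / 4 * (norm e)\<^sup>2" using tt by simp
    obtain \<gamma> :: "real \<Rightarrow> 'e" where \<gamma>: "\<gamma> 0 = p" "\<forall>\<^sub>F s in nhds 0. \<gamma> s \<in> M"
      "(\<gamma> has_vector_derivative v) (at 0)"
      using v(1) by (auto simp: tangent_space_def)
    define h where "h s = norm (f (\<gamma> s) - q)" for s
    have "(\<gamma> has_derivative (\<lambda>s. s *\<^sub>R v)) (at 0)"
      using \<gamma>(3) by (simp add: has_vector_derivative_def)
    moreover have "(f has_derivative D f p) (at (\<gamma> 0))"
      using f_der[OF M_\<Omega>[OF p(1)]] \<gamma>(1) by simp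
    ultimately have "((\<lambda>s. f (\<gamma> s)) has_derivative (\<lambda>s. D f p (s *\<^sub>R v))) (at 0)"
      by (rule has_derivative_compose)
    then have "((\<lambda>s. f (\<gamma> s) - q) has_derivative (\<lambda>s. D f p (s *\<^sub>R v) - 0)) (at 0)"
      by (rule has_derivative_diff[OF _ has_derivative_const])
    then have fq: "((\<lambda>s. f (\<gamma> s) - q) has_derivative (\<lambda>s. s *\<^sub>R t)) (at 0)"
      using f_lin[OF M_\<Omega>[OF p(1)]] by (simp add: linear_cmul v(2))
    have "f (\<gamma> 0) - q = - e" by (simp add: \<gamma>(1) f_M[OF p(1)] e_def)
    then have "(norm has_derivative (\<lambda>y. y \<bullet> sgn (- e))) (at (f (\<gamma> 0) - q))"
      using has_derivative_norm[of "- e"] e0 by auto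
    from has_derivative_compose[OF fq this]
    have "(h has_derivative (\<lambda>s. (s *\<^sub>R t) \<bullet> sgn (- e))) (at 0)"
      unfolding h_def[abs_def] .
    then have "(h has_real_derivative - ((norm t)\<^sup>2 / norm e)) (at 0)"
      unfolding has_field_derivative_def
      by (rule has_derivative_eq_rhs) (simp add: fun_eq_iff sgn_div_norm te inverse_eq_divide)
    then have lim1: "((\<lambda>s. (h s - h 0) / s) \<longlongrightarrow> - ((norm t)\<^sup>2 / norm e)) (at 0)"
      by (simp add: DERIV_def)
    have lim2: "((\<lambda>s. norm (\<gamma> s - p - s *\<^sub>R v) / norm s) \<longlongrightarrow> 0) (at 0)"
      using \<gamma>(1,3) by (simp add: has_vector_derivative_def has_derivative_at)
    \<comment> \<open>The second term of \<open>\<Phi>\<close> need not be differentiable along the curve, so it is estimated by difference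
      quotients from the right.\<close>
    have "- (((norm t)\<^sup>2) / norm e) \<ge> - (norm v + 0) / 2"
    proof (rule tendsto_le[of "at_right (0::real)"])
      show "((\<lambda>s. (h s - h 0) / s) \<longlongrightarrow> - ((norm t)\<^sup>2 / norm e)) (at_right 0)"
        by (rule tendsto_mono[OF at_le[OF subset_UNIV] lim1])
      have "((\<lambda>s. norm (\<gamma> s - p - s *\<^sub>R v) / norm s) \<longlongrightarrow> 0) (at_right 0)"
        by (rule tendsto_mono[OF at_le[OF subset_UNIV] lim2])
      then show "((\<lambda>s. - (norm v + norm (\<gamma> s - p - s *\<^sub>R v) / norm s) / 2) \<longlongrightarrow> - (norm v + 0) / 2) (at_right 0)"
        by (intro tendsto_intros) auto
      have "\<forall>\<^sub>F s in at_right 0. \<gamma> s \<in> M"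
        by (rule filter_leD[OF at_within_le_nhds \<gamma>(2)])
      moreover have "\<forall>\<^sub>F s::real in at_right 0. s > 0" by (rule eventually_at_right_less)
      ultimately show "\<forall>\<^sub>F s in at_right 0. - (norm v + norm (\<gamma> s - p - s *\<^sub>R v) / norm s) / 2 \<le> (h s - h 0) / s"
      proof eventually_elim
        case (elim s)
        have "\<Phi> p \<le> \<Phi> (\<gamma> s)" by (rule min[OF elim(1)])
        moreover have "dist (\<gamma> s) p0 \<le> dist (\<gamma> s) p + dist p p0" by (rule dist_triangle)
        moreover have "h s = dist (F (\<gamma> s)) q" "h 0 = dist (F p) q"
          using elim(1) p(1) by (simp_all add: h_def dist_norm f_M \<gamma>(1))
        ultimately have "h 0 - h s \<le> norm (\<gamma> s - p) / 2" by (simp add: \<Phi>_def dist_norm)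
        also have "norm (\<gamma> s - p) \<le> s * norm v + norm (\<gamma> s - p - s *\<^sub>R v)"
          using norm_triangle_ineq[of "s *\<^sub>R v" "\<gamma> s - p - s *\<^sub>R v"] elim(2) by simp
        finally have "h 0 - h s \<le> (s * norm v + norm (\<gamma> s - p - s *\<^sub>R v)) / 2" by simp
        then have "- ((s * norm v + norm (\<gamma> s - p - s *\<^sub>R v)) / 2) / s \<le> (h s - h 0) / s"
          using elim(2) by (intro divide_right_mono) linarith+
        moreover have "- ((s * norm v + norm (\<gamma> s - p - s *\<^sub>R v)) / 2) / s =
            - (norm v + norm (\<gamma> s - p - s *\<^sub>R v) / norm s) / 2"
          using elim(2) by (simp add: add_divide_distrib diff_divide_distrib)
        ultimately show ?case by (simp only:)
      qed
    qed simp
    then have "(norm t)\<^sup>2 / norm e \<le> norm t / 2" by (simp add: norm_v)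
    then have "norm t * norm t \<le> norm t * (norm e / 2)" using e0 by (simp add: field_simps power2_eq_square)
    then have "norm t \<le> norm e / 2" using mult_le_cancel_left_pos[of "norm t"] e0
      by (cases "norm t = 0") auto
    then have "(norm t)\<^sup>2 \<le> (norm e / 2)\<^sup>2" by (intro power_mono) auto
    then have "(norm t)\<^sup>2 \<le> (norm e)\<^sup>2 / 4" by (simp add: power_divide)
    then have "3 / 4 * (norm e)\<^sup>2 \<le> (norm e)\<^sup>2 / 4" using big by linarith
    moreover have "(norm e)\<^sup>2 > 0" using e0 by simp
    ultimately show False by linarith
  qed
  then show ?thesis using p(1) by blast
qed

lemma F_in_cylinder:
  assumes "x \<in> M"
  shows "F x \<in> cylinder c V r0"
proof -
  have "F x = c + (- r0 *\<^sub>R N x) + (g x - c)" by (simp add: g_M[OF assms])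
  moreover have "- r0 *\<^sub>R N x \<in> V\<^sup>\<bottom>"
    using N_perp_V[OF assms] by (intro subspace_scale subspace_orthogonal_comp)
  moreover have "norm (- r0 *\<^sub>R N x) = r0" using norm_N[OF assms] r0_pos by simp
  ultimately show ?thesis unfolding cylinder_def using g_in_axis[OF M_\<Omega>[OF assms]] by blast
qed

text \<open>By \<open>cylinder_step\<close> a point of the cylinder lies in the image if and only if all points of the
  cylinder that are closer than \<open>r0\<close> do, and the cylinder is connected.\<close>

lemma image_F: "F ` M = cylinder c V r0"
proof
  show "F ` M \<subseteq> cylinder c V r0" using F_in_cylinder by blast
  show "cylinder c V r0 \<subseteq> F ` M"
  proof
    fix q assume q: "q \<in> cylinder c V r0"
    have step: "y \<in> F ` M" if "x \<in> F ` M" "y \<in> cylinder c V r0" "dist x y < r0" for x y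
      using that cylinder_step by force
    have near: "\<forall>\<^sub>F b in at a within cylinder c V r0. (a \<in> F ` M) = (b \<in> F ` M)"
      if a: "a \<in> cylinder c V r0" for a
      unfolding eventually_at using r0_pos step a by (metis dist_commute)
    have conn: "connected (cylinder c V r0)"
      using connected_cylinder[OF subspace_V _ r0_pos] dim_V DIM_a m_pos by simp
    have "(F x0 \<in> F ` M) = (q \<in> F ` M)"
      using connected_local_const[OF conn F_in_cylinder[OF x0] q, of "\<lambda>a. a \<in> F ` M"] near by blast
    then show "q \<in> F ` M" using x0 by blast
  qed
qed

end

section \<open>Parallel hypersurfaces\<close>

context cylindrical_immersion
begin

lemma F_der_within: "x \<in> M \<Longrightarrow> (F has_derivative D f x) (at x within M)"
  and N_der_within: "x \<in> M \<Longrightarrow> (N has_derivative D \<nu> x) (at x within M)"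
  using has_derivative_within_M[of F x] has_derivative_within_M[of N x] f_smooth \<nu>_smooth
  by (simp_all add: f_def[abs_def] \<nu>_def[abs_def])

lemma differential_combination:
  assumes "\<And>y. y \<in> M \<Longrightarrow> G y = \<alpha> *\<^sub>R F y + \<beta> *\<^sub>R N y" and x: "x \<in> M" and v: "v \<in> tangent_space M x"
  shows "differential M G x v = \<alpha> *\<^sub>R D f x v + \<beta> *\<^sub>R D \<nu> x v"
proof -
  have der: "((\<lambda>y. \<alpha> *\<^sub>R F y + \<beta> *\<^sub>R N y) has_derivative (\<lambda>v. \<alpha> *\<^sub>R D f x v + \<beta> *\<^sub>R D \<nu> x v)) (at x within M)"
    by (rule has_derivative_add[OF has_derivative_scaleR_right[OF F_der_within[OF x]]
          has_derivative_scaleR_right[OF N_der_within[OF x]]])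
  have "(G has_derivative (\<lambda>v. \<alpha> *\<^sub>R D f x v + \<beta> *\<^sub>R D \<nu> x v)) (at x within M)"
    by (rule has_derivative_transform[OF x _ der]) (rule assms(1))
  from differential_eqI[OF this v] show ?thesis .
qed

lemma smooth_combination:
  assumes "\<And>y. y \<in> M \<Longrightarrow> G y = \<alpha> *\<^sub>R F y + \<beta> *\<^sub>R N y"
  shows "smooth_map M G"
  unfolding smooth_map_iff
proof
  fix k
  have "Ck_on k \<Omega> (\<lambda>p. \<alpha> *\<^sub>R f p + \<beta> *\<^sub>R \<nu> p)"
    by (intro Ck_on_add Ck_on_scaleR Ck_on_const open_\<Omega> f_smooth \<nu>_smooth)
  then show "Ck_on k \<Omega> (\<lambda>p. G (\<rho> p))"
    by (rule Ck_on_cong[OF open_\<Omega>, rotated]) (simp add: assms \<rho>_in f_def \<nu>_def)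
qed

lemma round_nonzero:
  assumes x: "x \<in> M"
  obtains a where "a \<in> round x" "a \<noteq> 0"
proof -
  have "\<not> round x \<subseteq> {0}"
  proof
    assume "round x \<subseteq> {0}"
    then have "dim (round x) = 0" by simp
    then show False using dim_round[OF x] m_pos by (simp add: round_def)
  qed
  then show thesis using that by blast
qed

lemma D_decomp:
  assumes x: "x \<in> M" and a: "a \<in> round x" and b: "b \<in> flat x"
  shows "D f x (a + b) = D f x a + D f x b" "D \<nu> x (a + b) = - (1 / r0) *\<^sub>R D f x a"
proof -
  show "D f x (a + b) = D f x a + D f x b" using f_lin[OF M_\<Omega>[OF x]] by (simp add: linear_add)
  have "D \<nu> x (a + b) = D \<nu> x a" using \<nu>_lin[OF M_\<Omega>[OF x]] flat_D[OF x b] by (simp add: linear_add)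
  then show "D \<nu> x (a + b) = - (1 / r0) *\<^sub>R D f x a" using round_D[OF x a] r0_pos by simp
qed

lemma inner_D_f:
  assumes x: "x \<in> M"
  shows "a \<in> round x \<Longrightarrow> a' \<in> round x \<Longrightarrow> D f x a \<bullet> D f x a' = a \<bullet> a'"
    "b \<in> flat x \<Longrightarrow> b' \<in> flat x \<Longrightarrow> D f x b \<bullet> D f x b' = b \<bullet> b'"
    "a \<in> round x \<Longrightarrow> b \<in> flat x \<Longrightarrow> D f x a \<bullet> D f x b = 0"
    "a \<in> round x \<Longrightarrow> b \<in> flat x \<Longrightarrow> D f x b \<bullet> D f x a = 0"
  using f_isometric[OF x] round_tangent[OF x] flat_tangent[OF x] round_orthogonal_flat[OF x]
  by (simp_all add: inner_commute)

lemma tangentE: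
  assumes "x \<in> M" "v \<in> tangent_space M x"
  obtains a b where "a \<in> round x" "b \<in> flat x" "v = a + b"
  using tangent_decomp[OF assms(1)] assms(2) by blast

lemma tangentI: "x \<in> M \<Longrightarrow> a \<in> round x \<Longrightarrow> b \<in> flat x \<Longrightarrow> a + b \<in> tangent_space M x"
  using tangent_decomp by blast

end

text \<open>Passing from \<open>F\<close> to \<open>F + \<mu> N\<close> multiplies the differential by \<open>l = 1 - \<mu> / r0\<close> on round directions and
  preserves it on flat ones. The factor \<open>l\<close> may be negative, when the focal set has been crossed; the
  uniqueness of the flow requires this case as well.\<close>

locale parallel_hypersurface = cylindrical_immersion M \<Omega> \<rho> F N r0 m d
  for M \<Omega> :: "'e::euclidean_space set" and \<rho> and F N :: "'e \<Rightarrow> 'a::euclidean_space" and r0 m d +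
  fixes F' :: "'e \<Rightarrow> 'a" and \<mu> l :: real
  assumes F': "x \<in> M \<Longrightarrow> F' x = F x + \<mu> *\<^sub>R N x"
  defines "l \<equiv> 1 - \<mu> / r0"
begin

lemma differential_F':
  assumes x: "x \<in> M" and a: "a \<in> round x" and b: "b \<in> flat x"
  shows "differential M F' x (a + b) = l *\<^sub>R D f x a + D f x b"
proof -
  have "differential M F' x (a + b) = 1 *\<^sub>R D f x (a + b) + \<mu> *\<^sub>R D \<nu> x (a + b)"
    by (rule differential_combination[OF _ x tangentI[OF assms]]) (simp add: F')
  then show ?thesis
    using r0_pos by (simp add: D_decomp[OF assms] l_def scaleR_diff_left)
qed

lemma smooth_F': "smooth_map M F'"
  by (rule smooth_combination[of _ 1 \<mu>]) (simp add: F')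

lemma metric_F':
  assumes x: "x \<in> M" and "a \<in> round x" "b \<in> flat x" "a' \<in> round x" "b' \<in> flat x"
  shows "induced_metric M F' x (a + b) (a' + b') = l\<^sup>2 * (a \<bullet> a') + b \<bullet> b'"
  using assms unfolding induced_metric_def
  by (simp add: differential_F' inner_add_left inner_add_right inner_D_f power2_eq_square)

lemma immersion_F':
  assumes l: "l \<noteq> 0"
  shows "immersion M F'"
  unfolding immersion_def
proof (intro conjI ballI smooth_F' inj_onI)
  fix x v w assume x: "x \<in> M" and v: "v \<in> tangent_space M x" and w: "w \<in> tangent_space M x"
    and eq: "differential M F' x v = differential M F' x w"
  obtain a b where ab: "a \<in> round x" "b \<in> flat x" "v = a + b" using tangentE[OF x v] .
  obtain a' b' where ab': "a' \<in> round x" "b' \<in> flat x" "w = a' + b'" using tangentE[OF x w] .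
  have A: "a - a' \<in> round x" and B: "b - b' \<in> flat x"
    using subspace_principal[OF x] ab ab' by (simp_all add: round_def flat_def subspace_diff)
  have "l *\<^sub>R D f x (a - a') + D f x (b - b') = 0"
    using eq f_lin[OF M_\<Omega>[OF x]] unfolding ab ab' differential_F'[OF x ab(1,2)] differential_F'[OF x ab'(1,2)]
    by (simp add: linear_diff scaleR_diff_right algebra_simps)
  then have "induced_metric M F' x ((a - a') + (b - b')) ((a - a') + (b - b')) = 0"
    by (simp add: induced_metric_def differential_F'[OF x A B])
  then have "l\<^sup>2 * ((a - a') \<bullet> (a - a')) + (b - b') \<bullet> (b - b') = 0"
    by (simp add: metric_F'[OF x A B A B])
  then have "l\<^sup>2 * ((a - a') \<bullet> (a - a')) = 0 \<and> (b - b') \<bullet> (b - b') = 0"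
    by (subst add_nonneg_eq_0_iff[symmetric]) auto
  then show "v = w" using l ab ab' by simp
qed

lemma immersion_F'_D:
  assumes "immersion M F'"
  shows "l \<noteq> 0"
proof
  assume l: "l = 0"
  obtain x where x: "x \<in> M" using M_nonempty by blast
  obtain a where a: "a \<in> round x" "a \<noteq> 0" by (rule round_nonzero[OF x])
  have 0: "0 \<in> round x" "0 \<in> flat x"
    using subspace_0[OF subspace_principal[OF x]] by (auto simp: round_def flat_def)
  have "differential M F' x (a + 0) = differential M F' x (0 + 0)"
    unfolding differential_F'[OF x a(1) 0(2)] differential_F'[OF x 0] by (simp add: l)
  then have "a = 0"
    using assms x round_tangent[OF x a(1)] round_tangent[OF x 0(1)]
    by (auto simp: immersion_def dest!: inj_onD)
  then show False using a by simp
qed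

lemma differential_F'_onto:
  assumes l: "l \<noteq> 0" and x: "x \<in> M" and u: "N x \<bullet> u = 0"
  shows "\<exists>v\<in>tangent_space M x. u = differential M F' x v"
proof -
  obtain w where w: "w \<in> tangent_space M x" "u = D f x w" using D_f_onto[OF x] u by blast
  obtain a b where ab: "a \<in> round x" "b \<in> flat x" "w = a + b" using tangentE[OF x w(1)] .
  have A: "(1 / l) *\<^sub>R a \<in> round x"
    using subspace_principal[OF x] ab(1) by (simp add: round_def subspace_scale)
  have "differential M F' x ((1 / l) *\<^sub>R a + b) = u"
    unfolding differential_F'[OF x A ab(2)] w ab
    using l f_lin[OF M_\<Omega>[OF x]] by (simp add: linear_cmul linear_add)
  then show ?thesis using tangentI[OF x A ab(2)] by metis
qed

text \<open>At each point the parallel hypersurface has the same normal line as \<open>F\<close>. The sign is a continuous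
  function with two values on a connected set.\<close>

lemma unit_normal_unique:
  assumes l: "l \<noteq> 0" and N': "unit_normal_field M F' N'"
  shows "\<exists>\<epsilon>. \<epsilon>\<^sup>2 = 1 \<and> (\<forall>x\<in>M. N' x = \<epsilon> *\<^sub>R N x)"
proof -
  have pt: "N' x = (N' x \<bullet> N x) *\<^sub>R N x" "(N' x \<bullet> N x)\<^sup>2 = 1" if x: "x \<in> M" for x
  proof -
    define y where "y = N' x - (N' x \<bullet> N x) *\<^sub>R N x"
    have NN: "N x \<bullet> N x = 1" using norm_N[OF x] by (simp add: dot_square_norm)
    have Ny: "N x \<bullet> y = 0" by (simp add: y_def inner_diff_right NN inner_commute)
    then have "N' x \<bullet> y = 0"
      using differential_F'_onto[OF l x Ny] N' x by (auto simp: unit_normal_field_def)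
    then have "y \<bullet> y = 0" using Ny by (simp add: y_def inner_diff_left)
    then show *: "N' x = (N' x \<bullet> N x) *\<^sub>R N x" by (simp add: y_def)
    have "norm (N' x) = 1" using N' x by (simp add: unit_normal_field_def)
    then have "\<bar>N' x \<bullet> N x\<bar> = 1" using norm_N[OF x] by (subst (asm) *) simp
    then show "(N' x \<bullet> N x)\<^sup>2 = 1" by (simp add: abs_square_eq_1)
  qed
  define \<phi> where "\<phi> p = N' (\<rho> p) \<bullet> \<nu> p" for p
  have "continuous_on \<Omega> (\<lambda>p. N' (\<rho> p))"
    using N' smooth_map_iff[of N'] unfolding unit_normal_field_def by (metis Ck_on.simps(1))
  moreover have "continuous_on \<Omega> \<nu>" using \<nu>_smooth[of 0] by simp
  ultimately have "continuous_on \<Omega> \<phi>" unfolding \<phi>_def[abs_def] by (rule continuous_on_inner)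
  moreover have "\<phi> ` \<Omega> \<subseteq> {1, -1}"
    using pt(2) \<rho>_in by (auto simp: \<phi>_def \<nu>_def power2_eq_1_iff)
  then have "finite (\<phi> ` \<Omega>)" by (rule finite_subset) simp
  ultimately have "\<phi> constant_on \<Omega>" by (rule continuous_finite_range_constant[OF connected_\<Omega>])
  then obtain \<epsilon> where \<epsilon>: "\<And>p. p \<in> \<Omega> \<Longrightarrow> \<phi> p = \<epsilon>" unfolding constant_on_def by blast
  have \<epsilon>M: "N' x \<bullet> N x = \<epsilon>" if "x \<in> M" for x
    using \<epsilon>[OF M_\<Omega>[OF that]] that by (simp add: \<phi>_def \<nu>_def \<rho>_id)
  show ?thesis
    using pt \<epsilon>M M_nonempty by (intro exI[of _ \<epsilon>]) (metis ex_in_conv)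
qed

context
  fixes \<epsilon> :: real and N' :: "'e \<Rightarrow> 'a"
  assumes \<epsilon>: "\<epsilon>\<^sup>2 = 1" and N': "\<And>x. x \<in> M \<Longrightarrow> N' x = \<epsilon> *\<^sub>R N x" and l: "l \<noteq> 0"
begin

lemma unit_normal_field_F': "unit_normal_field M F' N'"
  unfolding unit_normal_field_def
proof (intro conjI ballI)
  show "smooth_map M N'" by (rule smooth_combination[of _ 0 \<epsilon>]) (simp add: N')
  fix x assume x: "x \<in> M"
  show "norm (N' x) = 1"
    using \<epsilon> norm_N[OF x] by (auto simp: N'[OF x] power2_eq_1_iff)
  fix v assume "v \<in> tangent_space M x"
  then obtain a b where "a \<in> round x" "b \<in> flat x" "v = a + b" using tangentE[OF x] by metis
  then show "N' x \<bullet> differential M F' x v = 0"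
    using normal_f[OF M_\<Omega>[OF x]] by (simp add: differential_F'[OF x] N'[OF x] inner_add_right \<nu>_M[OF x])
qed

lemma second_form_F':
  assumes x: "x \<in> M" and ab: "a \<in> round x" "b \<in> flat x" "a' \<in> round x" "b' \<in> flat x"
  shows "second_fundamental_form M F' N' x (a + b) (a' + b') = \<epsilon> * l / r0 * (a \<bullet> a')"
proof -
  have "differential M N' x (a + b) = 0 *\<^sub>R D f x (a + b) + \<epsilon> *\<^sub>R D \<nu> x (a + b)"
    by (rule differential_combination[OF _ x tangentI[OF x ab(1,2)]]) (simp add: N')
  then have "differential M N' x (a + b) = (- \<epsilon> / r0) *\<^sub>R D f x a"
    by (simp add: D_decomp[OF x ab(1,2)])
  then show ?thesis
    using ab unfolding second_fundamental_form_def
    by (simp add: differential_F'[OF x ab(3,4)] inner_add_right inner_D_f[OF x])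
qed

lemma principal_space_F':
  assumes x: "x \<in> M" and ab: "a \<in> round x" "b \<in> flat x"
  shows "a + b \<in> principal_space M F' N' x \<kappa> \<longleftrightarrow> (\<kappa> = \<epsilon> / (r0 * l) \<or> a = 0) \<and> (\<kappa> = 0 \<or> b = 0)"
proof -
  have 0: "0 \<in> round x" "0 \<in> flat x"
    using subspace_0[OF subspace_principal[OF x]] by (auto simp: round_def flat_def)
  have "a + b \<in> principal_space M F' N' x \<kappa> \<longleftrightarrow>
    (\<forall>a'\<in>round x. \<forall>b'\<in>flat x. \<epsilon> * l / r0 * (a \<bullet> a') = \<kappa> * (l\<^sup>2 * (a \<bullet> a') + b \<bullet> b'))"
    (is "_ = ?P")
  proof
    assume L: "a + b \<in> principal_space M F' N' x \<kappa>"
    show ?P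
    proof (intro ballI)
      fix a' b' assume w: "a' \<in> round x" "b' \<in> flat x"
      have "second_fundamental_form M F' N' x (a + b) (a' + b') = \<kappa> * induced_metric M F' x (a + b) (a' + b')"
        using L tangentI[OF x w] by (simp add: principal_space_def)
      then show "\<epsilon> * l / r0 * (a \<bullet> a') = \<kappa> * (l\<^sup>2 * (a \<bullet> a') + b \<bullet> b')"
        by (simp only: second_form_F'[OF x ab w] metric_F'[OF x ab w])
    qed
  next
    assume P: ?P
    show "a + b \<in> principal_space M F' N' x \<kappa>"
      unfolding principal_space_def
    proof (intro CollectI conjI ballI tangentI[OF x ab])
      fix w assume "w \<in> tangent_space M x"
      then obtain a' b' where w: "a' \<in> round x" "b' \<in> flat x" "w = a' + b'" using tangentE[OF x] by metis
      show "second_fundamental_form M F' N' x (a + b) w = \<kappa> * induced_metric M F' x (a + b) w"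
        unfolding w(3) second_form_F'[OF x ab w(1,2)] metric_F'[OF x ab w(1,2)]
        using P w(1,2) by blast
    qed
  qed
  also have "?P \<longleftrightarrow> (\<kappa> = \<epsilon> / (r0 * l) \<or> a = 0) \<and> (\<kappa> = 0 \<or> b = 0)"
  proof
    assume P: ?P
    have "\<epsilon> * l / r0 * (a \<bullet> a) = \<kappa> * (l\<^sup>2 * (a \<bullet> a) + b \<bullet> 0)" using P ab 0 by blast
    then have "(\<epsilon> * l / r0 - \<kappa> * l\<^sup>2) * (a \<bullet> a) = 0" by (simp add: algebra_simps)
    then have "\<epsilon> * l / r0 = \<kappa> * l\<^sup>2 \<or> a = 0" by simp
    then have "\<kappa> = \<epsilon> / (r0 * l) \<or> a = 0" using l r0_pos by (auto simp: field_simps power2_eq_square)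
    moreover have "\<epsilon> * l / r0 * (a \<bullet> 0) = \<kappa> * (l\<^sup>2 * (a \<bullet> 0) + b \<bullet> b)" using P ab 0 by blast
    then have "\<kappa> = 0 \<or> b = 0" by auto
    ultimately show "(\<kappa> = \<epsilon> / (r0 * l) \<or> a = 0) \<and> (\<kappa> = 0 \<or> b = 0)" by blast
  next
    assume R: "(\<kappa> = \<epsilon> / (r0 * l) \<or> a = 0) \<and> (\<kappa> = 0 \<or> b = 0)"
    have "\<epsilon> * l / r0 = \<kappa> * l\<^sup>2" if "\<kappa> = \<epsilon> / (r0 * l)"
      using that l r0_pos by (simp add: field_simps power2_eq_square)
    then have "\<epsilon> * l / r0 = \<kappa> * l\<^sup>2 \<or> a = 0" using R by blast
    then have "\<epsilon> * l / r0 * (a \<bullet> a') = \<kappa> * l\<^sup>2 * (a \<bullet> a')" for a' by (elim disjE) (simp_all only: inner_zero_left mult_zero_right)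
    moreover have "\<kappa> * (b \<bullet> b') = 0" for b' using R by auto
    ultimately show ?P by (simp add: distrib_left mult.assoc)
  qed
  finally show ?thesis .
qed

text \<open>The principal curvature \<open>1 / r0\<close> becomes \<open>\<epsilon> / (r0 l)\<close> with the same principal space, and the curvature
  0 does not contribute.\<close>

lemma mean_curvature_F':
  assumes x: "x \<in> M"
  shows "mean_curvature M F' N' x = real m * \<epsilon> / (r0 * l)"
proof -
  define \<kappa> where "\<kappa> = \<epsilon> / (r0 * l)"
  have \<kappa>0: "\<kappa> \<noteq> 0" using \<epsilon> l r0_pos by (auto simp: \<kappa>_def)
  let ?C = "principal_curvatures M F' N' x"
  have P: "principal_space M F' N' x \<kappa> = round x"
  proof (intro equalityI subsetI)
    fix v assume v: "v \<in> principal_space M F' N' x \<kappa>"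
    then have "v \<in> tangent_space M x" by (simp add: principal_space_def)
    then obtain a b where ab: "a \<in> round x" "b \<in> flat x" "v = a + b" using tangentE[OF x] by metis
    then show "v \<in> round x" using v \<kappa>0 principal_space_F'[OF x ab(1,2), of \<kappa>] by simp
  next
    fix a assume a: "a \<in> round x"
    have "0 \<in> flat x" using subspace_0[OF subspace_principal[OF x]] by (simp add: flat_def)
    then show "a \<in> principal_space M F' N' x \<kappa>"
      using principal_space_F'[OF x a, of 0 \<kappa>] by (simp add: \<kappa>_def)
  qed
  obtain a where "a \<in> round x" "a \<noteq> 0" by (rule round_nonzero[OF x])
  then have \<kappa>C: "{\<kappa>} \<subseteq> ?C" unfolding principal_curvatures_def using P by blast
  have sub: "?C \<subseteq> {\<kappa>, 0}"
  proof
    fix \<kappa>' assume "\<kappa>' \<in> ?C"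
    then obtain v where v: "v \<in> principal_space M F' N' x \<kappa>'" "v \<noteq> 0"
      by (auto simp: principal_curvatures_def)
    then have "v \<in> tangent_space M x" by (simp add: principal_space_def)
    then obtain a b where ab: "a \<in> round x" "b \<in> flat x" "v = a + b" using tangentE[OF x] by metis
    then show "\<kappa>' \<in> {\<kappa>, 0}" using v principal_space_F'[OF x ab(1,2), of \<kappa>'] by (auto simp: \<kappa>_def)
  qed
  then have "finite ?C" by (rule finite_subset) simp
  then have "mean_curvature M F' N' x = (\<Sum>\<kappa>\<in>{\<kappa>}. real (dim (principal_space M F' N' x \<kappa>)) * \<kappa>)"
    unfolding mean_curvature_def using \<kappa>C sub by (intro sum.mono_neutral_right) auto
  then show ?thesis using P dim_round[OF x] by (simp add: \<kappa>_def round_def)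
qed

end

end

section \<open>The flow\<close>

context cylindrical_immersion
begin

definition flow where "flow t x = F x + (r0 * (1 - exp (t / real m))) *\<^sub>R N x"

lemma flow_solution: "imcf_parallel_solution M UNIV F N flow"
proof -
  have slice: "immersion M (flow t) \<and> inward_unit_normal M (flow t) N \<and>
    (\<forall>x\<in>M. mean_curvature M (flow t) N x = real m / (r0 * exp (t / real m)))" for t
  proof -
    define \<mu> where "\<mu> = r0 * (1 - exp (t / real m))"
    interpret P: parallel_hypersurface M \<Omega> \<rho> F N r0 m d "flow t" \<mu> "1 - \<mu> / r0"
      by unfold_locales (simp_all add: flow_def \<mu>_def)
    have l: "1 - \<mu> / r0 = exp (t / real m)" using r0_pos by (simp add: \<mu>_def)
    then have l0: "1 - \<mu> / r0 \<noteq> 0" by simp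
    have H: "mean_curvature M (flow t) N x = real m / (r0 * exp (t / real m))" if "x \<in> M" for x
      using P.mean_curvature_F'[OF _ _ l0 that, of 1 N] by (simp add: l)
    then show ?thesis
      using P.immersion_F'[OF l0] P.unit_normal_field_F'[OF _ _ l0, of 1 N] m_pos r0_pos
      by (simp add: inward_unit_normal_def)
  qed
  have "((\<lambda>s. flow s x) has_vector_derivative (- (1 / mean_curvature M (flow t) N x)) *\<^sub>R N x) (at t within UNIV)"
    if x: "x \<in> M" for t x
  proof -
    have "1 / mean_curvature M (flow t) N x = r0 * exp (t / real m) / real m"
      using slice[of t] x by simp
    then have "((\<lambda>s. r0 * (1 - exp (s / real m))) has_real_derivative - (1 / mean_curvature M (flow t) N x)) (at t)"
      using m_pos by (auto intro!: derivative_eq_intros)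
    from has_vector_derivative_add[OF has_vector_derivative_const
        has_vector_derivative_scaleR[OF this has_vector_derivative_const], of "F x" "N x"]
    show ?thesis by (simp add: flow_def)
  qed
  then have "imcf_solution M UNIV F flow"
    unfolding imcf_solution_def using slice
    by (auto simp: flow_def is_interval_univ intro!: exI[of _ "\<lambda>t. N"])
  then show ?thesis
    unfolding imcf_parallel_solution_def
    by (auto simp: flow_def intro!: exI[of _ "\<lambda>t. r0 * (1 - exp (t / real m))"])
qed

text \<open>Let \<open>F + \<mu> N\<close> be any solution by parallel hypersurfaces. Its unit normal is \<open>\<epsilon> N\<close> with \<open>\<epsilon> = 1\<close> or \<open>\<epsilon> = - 1\<close>, and the sign
  enters both the normal and the mean curvature, so it cancels in the flow equation. What remains is the
  linear equation \<open>\<mu>' = - (r0 - \<mu>) / m\<close> with \<open>\<mu> 0 = 0\<close>.\<close>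

lemma flow_unique:
  assumes sol: "imcf_parallel_solution M I F N Gt" and t: "t \<in> I" and p: "p \<in> M"
  shows "Gt t p = flow t p"
proof -
  obtain \<mu> where \<mu>: "\<And>t x. t \<in> I \<Longrightarrow> x \<in> M \<Longrightarrow> Gt t x = F x + \<mu> t *\<^sub>R N x"
    using sol unfolding imcf_parallel_solution_def by blast
  have I: "is_interval I" "0 \<in> I" and Gt0: "\<And>x. x \<in> M \<Longrightarrow> Gt 0 x = F x"
    using sol unfolding imcf_parallel_solution_def imcf_solution_def by blast+
  obtain N' where imm: "\<And>t. t \<in> I \<Longrightarrow> immersion M (Gt t)"
    and N': "\<And>t. t \<in> I \<Longrightarrow> unit_normal_field M (Gt t) (N' t)"
    and der: "\<And>t x. t \<in> I \<Longrightarrow> x \<in> M \<Longrightarrow> ((\<lambda>s. Gt s x) has_vector_derivative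
           (- (1 / mean_curvature M (Gt t) (N' t) x)) *\<^sub>R N' t x) (at t within I)"
    using sol unfolding imcf_parallel_solution_def imcf_solution_def inward_unit_normal_def by blast
  have NN: "N p \<bullet> N p = 1" using norm_N[OF p] by (simp add: dot_square_norm)
  have \<mu>': "(\<mu> has_real_derivative - ((r0 - \<mu> s) / real m)) (at s within I)" if s: "s \<in> I" for s
  proof -
    interpret P: parallel_hypersurface M \<Omega> \<rho> F N r0 m d "Gt s" "\<mu> s" "1 - \<mu> s / r0"
      by unfold_locales (simp_all add: \<mu>[OF s])
    have l: "1 - \<mu> s / r0 \<noteq> 0" by (rule P.immersion_F'_D[OF imm[OF s]])
    obtain \<epsilon> where \<epsilon>: "\<epsilon>\<^sup>2 = 1" "\<And>x. x \<in> M \<Longrightarrow> N' s x = \<epsilon> *\<^sub>R N x"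
      using P.unit_normal_unique[OF l N'[OF s]] by blast
    have H: "mean_curvature M (Gt s) (N' s) p = real m * \<epsilon> / (r0 * (1 - \<mu> s / r0))"
      by (rule P.mean_curvature_F'[OF \<epsilon> l p])
    have v: "- (1 / mean_curvature M (Gt s) (N' s) p) * \<epsilon> = - ((r0 - \<mu> s) / real m)"
      using \<epsilon>(1) r0_pos m_pos unfolding H by (auto simp: power2_eq_1_iff field_simps)
    have "((\<lambda>u. (Gt u p - F p) \<bullet> N p) has_vector_derivative
        ((- (1 / mean_curvature M (Gt s) (N' s) p)) *\<^sub>R N' s p - 0) \<bullet> N p) (at s within I)"
      by (intro bounded_linear.has_vector_derivative[OF bounded_linear_inner_left]
          has_vector_derivative_diff der s p has_vector_derivative_const)
    then have "((\<lambda>u. (Gt u p - F p) \<bullet> N p) has_vector_derivative - ((r0 - \<mu> s) / real m)) (at s within I)"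
      using v by (simp add: \<epsilon>(2)[OF p] NN)
    then have "(\<mu> has_vector_derivative - ((r0 - \<mu> s) / real m)) (at s within I)"
      by (rule has_vector_derivative_transform[OF s, rotated]) (simp add: \<mu> p NN)
    then show ?thesis by (simp add: has_real_derivative_iff_has_vector_derivative)
  qed
  \<comment> \<open>an integral of the linear equation\<close>
  have "((\<lambda>s. (r0 - \<mu> s) * exp (- (s / real m))) has_real_derivative 0) (at s within I)" if s: "s \<in> I" for s
    using m_pos by (auto intro!: derivative_eq_intros \<mu>'[OF s] simp: field_simps)
  then have "\<exists>C. \<forall>s\<in>I. (r0 - \<mu> s) * exp (- (s / real m)) = C"
    by (rule has_field_derivative_zero_constant[OF is_interval_convex[OF I(1)]])
  then obtain C where C: "\<And>s. s \<in> I \<Longrightarrow> (r0 - \<mu> s) * exp (- (s / real m)) = C" by blast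
  have "\<mu> 0 *\<^sub>R N p = 0" using \<mu>[OF I(2) p] Gt0[OF p] by simp
  then have "\<mu> 0 = 0" using NN by auto
  then have "(r0 - \<mu> t) * exp (- (t / real m)) = r0" using C[OF t] C[OF I(2)] by simp
  then have "\<mu> t = r0 * (1 - exp (t / real m))" by (simp add: exp_minus field_simps)
  then show ?thesis using \<mu>[OF t p] by (simp add: flow_def)
qed

lemma flow_eq: "x \<in> M \<Longrightarrow> flow t x = g x - (r0 * exp (t / real m)) *\<^sub>R N x"
  by (simp add: flow_def g_M algebra_simps)

text \<open>In terms of the focal map and the normal, \<open>F x = g x - r0 N x\<close> and the flow replaces \<open>r0\<close> by the
  current radius. Surjectivity of \<open>F\<close> onto its cylinder says that \<open>(g, N)\<close> attains all values in the
  product of the axis and the unit sphere of \<open>V\<^sup>\<bottom>\<close>.\<close>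

lemma image_flow: "flow t ` M = cylinder c V (r0 * exp (t / real m))"
proof (intro equalityI subsetI)
  let ?r = "r0 * exp (t / real m)"
  have r: "?r > 0" using r0_pos by simp
  fix y assume "y \<in> flow t ` M"
  then obtain x where x: "x \<in> M" "y = g x - ?r *\<^sub>R N x" using flow_eq by auto
  have "- ?r *\<^sub>R N x \<in> V\<^sup>\<bottom>" by (rule subspace_scale[OF subspace_orthogonal_comp N_perp_V[OF x(1)]])
  moreover have "norm (- ?r *\<^sub>R N x) = ?r" using norm_N[OF x(1)] r by simp
  moreover have "y = c + (- ?r *\<^sub>R N x) + (g x - c)" by (simp add: x)
  ultimately show "y \<in> cylinder c V ?r"
    using g_in_axis[OF M_\<Omega>[OF x(1)]] unfolding cylinder_def by blast
next
  let ?r = "r0 * exp (t / real m)"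
  have r: "?r > 0" using r0_pos by simp
  fix y assume "y \<in> cylinder c V ?r"
  then obtain u v where uv: "u \<in> V\<^sup>\<bottom>" "norm u = ?r" "v \<in> V" "y = c + u + v"
    by (auto simp: cylinder_def)
  define w where "w = (r0 / ?r) *\<^sub>R u"
  have w: "w \<in> V\<^sup>\<bottom>" "norm w = r0"
    using uv r r0_pos subspace_scale[OF subspace_orthogonal_comp uv(1)] by (auto simp: w_def)
  then have "c + w + v \<in> F ` M" unfolding image_F cylinder_def using uv by blast
  then obtain x where x: "x \<in> M" "c + w + v = F x" by (metis imageE)
  define z where "z = w + r0 *\<^sub>R N x"
  have "z \<in> V\<^sup>\<bottom>"
    unfolding z_def by (intro subspace_add subspace_scale subspace_orthogonal_comp w N_perp_V x)
  moreover have z: "z = (g x - c) - v" using x by (simp add: z_def g_M algebra_simps)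
  then have "z \<in> V" using subspace_diff[OF subspace_V g_in_axis[OF M_\<Omega>[OF x(1)]] uv(3)] by simp
  ultimately have "z = 0" using orthogonal_Int_0[OF subspace_V] by blast
  then have "g x = c + v" "w = - r0 *\<^sub>R N x"
    using z by (simp_all add: z_def eq_neg_iff_add_eq_0 diff_eq_eq add.commute)
  moreover have "u = (?r / r0) *\<^sub>R w" using r r0_pos by (simp add: w_def)
  ultimately have "y = flow t x" using r0_pos by (simp add: flow_eq[OF x(1)] uv(4))
  then show "y \<in> flow t ` M" using x by blast
qed

lemma flow_collapse:
  "hausdorff_tendsto (\<lambda>t. flow t ` M) ((\<lambda>v. c + v) ` V) at_bot"
  unfolding image_flow
proof (rule cylinder_hausdorff_tendsto[OF subspace_V])
  show "dim V < DIM('a)" using dim_V DIM_a by simp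
  have "filterlim (\<lambda>t. inverse (real m) * t) at_bot at_bot"
    using m_pos by (intro filterlim_tendsto_pos_mult_at_bot[OF tendsto_const _ filterlim_ident]) auto
  then have "((\<lambda>t. exp (inverse (real m) * t)) \<longlongrightarrow> 0) at_bot"
    by (rule filterlim_compose[OF exp_at_bot])
  then have "((\<lambda>t. r0 * exp (inverse (real m) * t)) \<longlongrightarrow> 0) at_bot" by (rule tendsto_mult_right_zero)
  then show "((\<lambda>t. r0 * exp (t / real m)) \<longlongrightarrow> 0) at_bot" by (simp add: divide_inverse mult.commute)
  show "r0 * exp (t / real m) > 0" for t using r0_pos by simp
qed

end

section \<open>Products of a sphere and a linear space\<close>

text \<open>Radial projection on the first factor and any linear projection onto \<open>W\<close> on the second; the
  punctured space is connected in dimension at least 2.\<close>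

lemma smooth_retract_sphere_times:
  fixes W :: "'c::euclidean_space set"
  assumes r0: "r0 > 0" and W: "subspace W" and dim: "DIM('b) \<ge> 2"
  obtains \<Omega> :: "('b::euclidean_space \<times> 'c) set" and \<rho> where "smooth_retract (sphere 0 r0 \<times> W) \<Omega> \<rho>" "connected \<Omega>"
proof -
  obtain P :: "'c \<Rightarrow> 'c" where P: "linear P" "\<And>y. P y \<in> W" "\<And>y. y \<in> W \<Longrightarrow> P y = y"
    using linear_exists_left_inverse_on[OF linear_id W] by auto
  let ?M = "sphere (0::'b) r0 \<times> W"
  let ?\<Omega> = "{x::'b. x \<noteq> 0} \<times> (UNIV :: 'c set)"
  let ?\<rho> = "\<lambda>p::'b \<times> 'c. (r0 * inverse (norm (fst p))) *\<^sub>R (fst p, 0) + (0, P (snd p))"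
  have "smooth_retract ?M ?\<Omega> ?\<rho>"
  proof
    show op: "open ?\<Omega>" by (intro open_Times open_nonzero open_UNIV)
    show "?M \<subseteq> ?\<Omega>" using r0 by auto
    show "?\<rho> p \<in> ?M" if "p \<in> ?\<Omega>" for p using that r0 P(2) by (auto simp: dist_norm)
    show "?\<rho> x = x" if "x \<in> ?M" for x using that r0 P(3) by (auto simp: dist_norm)
    fix k
    have "Ck_on k ?\<Omega> (\<lambda>p. inverse (norm (fst p)) ^ 1)"
      by (rule Ck_on_compose[OF open_nonzero op _ Ck_on_linear[OF op bounded_linear_fst] Ck_on_inverse_norm_power]) auto
    then have "Ck_on k ?\<Omega> (\<lambda>p. r0 *\<^sub>R inverse (norm (fst p)))"
      by (intro Ck_on_scaleR Ck_on_const op) simp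
    moreover have "Ck_on k ?\<Omega> (\<lambda>p. (fst p, 0))" "Ck_on k ?\<Omega> (\<lambda>p. (0, P (snd p)))"
      by (intro Ck_on_linear[OF op] bounded_linear_Pair bounded_linear_fst bounded_linear_zero
          bounded_linear_compose[OF _ bounded_linear_snd] linear_conv_bounded_linear[THEN iffD1, OF P(1)])+
    ultimately show "Ck_on k ?\<Omega> ?\<rho>"
      by (intro Ck_on_add Ck_on_scaleR op) auto
  qed
  moreover have "connected ?\<Omega>"
  proof (intro connected_Times convex_connected[OF convex_UNIV])
    have "- {0::'b} = {x. x \<noteq> 0}" by auto
    then show "connected {x::'b. x \<noteq> 0}" using connected_punctured_universe[OF dim, of 0] by simp
  qed
  ultimately show thesis using that by blast
qed

theorem theorem3p2:
  fixes n m :: nat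
    and r0 :: real
    and W :: "'c::euclidean_space set"
    and M :: "('b::euclidean_space \<times> 'c) set"
    and F N :: "'b \<times> 'c \<Rightarrow> 'a::euclidean_space"
  assumes "m \<noteq> 0" and "m \<le> n" and "r0 > 0"
    and "DIM('a) = n + 1" and "DIM('b) = m + 1"
    and "subspace W" and "dim W = n - m"
    and M_def: "M = sphere 0 r0 \<times> W"
    and "isometric_immersion M F"
    and "inward_unit_normal M F N"
    and "\<forall>x\<in>M. dim (principal_space M F N x (1 / r0)) = m"
    and "m \<noteq> n \<longrightarrow> (\<forall>x\<in>M. dim (principal_space M F N x 0) = n - m)"
  shows "\<exists>Ft. imcf_parallel_solution M UNIV F N Ft \<and>
    (\<forall>I Gt. imcf_parallel_solution M I F N Gt \<longrightarrow> (\<forall>t\<in>I. \<forall>p\<in>M. Gt t p = Ft t p)) \<and>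
    (m = n \<longrightarrow>
      (\<exists>c. F ` M = sphere c r0 \<and>
        (\<forall>t. \<forall>x\<in>sphere 0 r0. Ft t (x, 0) = c + exp (t / real n) *\<^sub>R (F (x, 0) - c)) \<and>
        (c = 0 \<longrightarrow> (\<forall>t. \<forall>x\<in>sphere 0 r0. Ft t (x, 0) = exp (t / real n) *\<^sub>R F (x, 0))) \<and>
        (\<forall>t. Ft t ` M = sphere c (r0 * exp (t / real n))) \<and>
        hausdorff_tendsto (\<lambda>t. Ft t ` M) {c} at_bot)) \<and>
    (m \<noteq> n \<longrightarrow>
      (\<forall>t. \<forall>x\<in>sphere 0 r0. \<forall>y\<in>W.
        Ft t (x, y) = F (x, y) + (r0 * (1 - exp (t / real m))) *\<^sub>R N (x, y)) \<and>
      (\<exists>c V. subspace V \<and> dim V = n - m \<and>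
        (\<forall>t. Ft t ` M = cylinder c V (r0 * exp (t / real m))) \<and>
        hausdorff_tendsto (\<lambda>t. Ft t ` M) ((\<lambda>v. c + v) ` V) at_bot))"
proof -
  obtain \<Omega> :: "('b \<times> 'c) set" and \<rho> where retract: "smooth_retract M \<Omega> \<rho>" and conn: "connected \<Omega>"
    unfolding M_def by (rule smooth_retract_sphere_times[OF \<open>r0 > 0\<close> \<open>subspace W\<close>])
      (use assms in auto)
  have "sphere (0::'b) r0 \<noteq> {}" using \<open>r0 > 0\<close> by simp
  moreover have W0: "0 \<in> W" using \<open>subspace W\<close> by (rule subspace_0)
  ultimately have "M \<noteq> {}" unfolding M_def by blast
  interpret C: cylindrical_immersion M \<Omega> \<rho> F N r0 m "n - m"
  proof (rule cylindrical_immersion.intro[OF retract cylindrical_immersion_axioms.intro])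
    show "closed M" unfolding M_def using closed_subspace[OF \<open>subspace W\<close>] by (intro closed_Times) auto
    show "unit_normal_field M F N" using assms by (simp add: inward_unit_normal_def)
  qed (use assms conn \<open>M \<noteq> {}\<close> in auto)
  have m1: "m = n \<Longrightarrow> C.V = {0}"
    using C.dim_V subspace_0[OF C.subspace_V] by (auto simp: dim_eq_0)
  show ?thesis
  proof (intro exI[of _ C.flow] conjI impI)
    show "imcf_parallel_solution M UNIV F N C.flow" by (rule C.flow_solution)
    show "\<forall>I Gt. imcf_parallel_solution M I F N Gt \<longrightarrow> (\<forall>t\<in>I. \<forall>p\<in>M. Gt t p = C.flow t p)"
      using C.flow_unique by blast
  next
    assume "m = n"
    then have V: "C.V = {0}" by (rule m1)
    have flow: "C.flow t (x, 0) = C.c + exp (t / real n) *\<^sub>R (F (x, 0) - C.c)" if "x \<in> sphere 0 r0" for t x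
    proof -
      have x: "(x, 0) \<in> M" using that W0 by (simp add: M_def)
      have "C.g (x, 0) = C.c" using C.g_in_axis[OF C.M_\<Omega>[OF x]] by (simp add: V)
      then have "F (x, 0) - C.c = - r0 *\<^sub>R N (x, 0)" using C.g_M[OF x] by (simp add: algebra_simps)
      then show ?thesis
        using C.flow_eq[OF x, of t] \<open>C.g (x, 0) = C.c\<close> \<open>m = n\<close> by simp
    qed
    have "hausdorff_tendsto (\<lambda>t. C.flow t ` M) {C.c} at_bot"
      using C.flow_collapse by (simp add: V)
    moreover have "F ` M = sphere C.c r0" using C.image_F by (simp add: V cylinder_0)
    moreover have "C.flow t ` M = sphere C.c (r0 * exp (t / real n))" for t
      using C.image_flow[of t] \<open>m = n\<close> by (simp add: V cylinder_0)
    ultimately show "\<exists>c. F ` M = sphere c r0 \<and>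
        (\<forall>t. \<forall>x\<in>sphere 0 r0. C.flow t (x, 0) = c + exp (t / real n) *\<^sub>R (F (x, 0) - c)) \<and>
        (c = 0 \<longrightarrow> (\<forall>t. \<forall>x\<in>sphere 0 r0. C.flow t (x, 0) = exp (t / real n) *\<^sub>R F (x, 0))) \<and>
        (\<forall>t. C.flow t ` M = sphere c (r0 * exp (t / real n))) \<and>
        hausdorff_tendsto (\<lambda>t. C.flow t ` M) {c} at_bot"
      using flow by (intro exI[of _ C.c]) auto
  next
    show "\<forall>t. \<forall>x\<in>sphere 0 r0. \<forall>y\<in>W. C.flow t (x, y) =
        F (x, y) + (r0 * (1 - exp (t / real m))) *\<^sub>R N (x, y)"
      by (simp add: C.flow_def)
    show "\<exists>c V. subspace V \<and> dim V = n - m \<and>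
        (\<forall>t. C.flow t ` M = cylinder c V (r0 * exp (t / real m))) \<and>
        hausdorff_tendsto (\<lambda>t. C.flow t ` M) ((\<lambda>v. c + v) ` V) at_bot"
      using C.subspace_V C.dim_V C.image_flow C.flow_collapse by blast
  qed
qed

end
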